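(* Let $n\ge4$ and consider a line network with nodes $\{1,\dots,n\}$, where $1$ is the source node and $n$ the final leaf node, operated under the $\Delta$-ENDiCo-OPF algorithm. Suppose the convergence-preservation assumption stated in the context holds. Then global convergence of the line system $\{1,\dots,n\}$ is guaranteed if there are iteration steps $t_1,\dots,t_{n-2}$ with $t_{i+1}\ge t_i+1$ such that the following conditions hold in a sequential manner for each local subsystem $\{i,i+1,i+2\}$, $i=1,\dots,n-2$. First, $\frac1{\Delta^{(t_i)}}v_{i+1}^{(t_i-1)}\le v_{i+1}^{(t_i)}\le\Delta^{(t_i)}v_{i+1}^{(t_i-1)}$ holds with $\Delta^{(t_i)}=1$. Second, writing $j=i+1$, $k=i+2$, $s=t_i$: (1) $x_{ij}-r_{ij}\ge 0$; (2) $v_i^{(s-1)}v_j^{(s-1)}-4P_{ij}^{(s+1)}r_{ij}v_j^{(s-1)}-4P_{jk}^{(s)}r_{jk}v_i^{(s-1)}\ge 0$; (3) $v_i^{(s-1)}v_j^{(s-1)}-4P_{ij}^{(s)}r_{ij}v_j^{(s-1)}-4P_{jk}^{(s)}r_{jk}v_i^{(s-1)}\ge 0$; (4) $v_i^{(s-1)}-4P_{ij}^{(s+1)}r_{ij}-4P_{ij}^{(s)}r_{ij}\ge 0$; (5) $v_i^{(s-1)}-4P_{ij}^{(s+1)}r_{ij}-2P_{ij}^{(s)}r_{ij}-2P_{ij}^{(s)}x_{ij}\ge 0$; (6) $v_i^{(s-1)}-4P_{ij}^{(s)}r_{ij}-4P_{ij}^{(s)}x_{ij}\ge 0$; (7)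 $v_i^{(s-1)}-P_{ij}^{(s+1)}r_{ij}-P_{jk}^{(s)}r_{jk}\ge 0$; (8) $v_i^{(s-1)}v_j^{(s-1)}-4P_{jk}^{(s)}r_{jk}v_i^{(s-1)}-2P_{ij}^{(s)}r_{ij}v_j^{(s-1)}-2P_{ij}^{(s)}x_{ij}v_j^{(s-1)}\ge 0$; (9) $(v_j^{(s-1)})^3-4P_{ij}^{(s+1)}r_{ij}v_i^{(s-1)}v_j^{(s-1)}-2P_{jk}^{(s)}r_{jk}v_i^{(s-1)}-4P_{ij}^{(s+1)}r_{ij}\ge 0$; (10) $v_i^{(s-1)}-8P_{ij}^{(s)}r_{ij}\ge 0$; (11) $v_i^{(s-1)}-8Q_{ij}^{(s)}x_{ij}\ge 0$; (12) $v_i^{(s-1)}-8P_{jk}^{(s)}r_{jk}\ge 0$.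
   Context: Network. A single-phase power distribution line network. Each line $(i,j)$ has resistance $r_{ij}$ and reactance $x_{ij}$. $P_{ij},Q_{ij}$ are the sending-end active and reactive power flows, $v_j$ is the squared voltage magnitude at node $j$, $\ell_{ij}$ is the squared current magnitude on line $(i,j)$, $p_{Lj},q_{Lj}$ are the active and reactive loads at node $j$, and $p_{Dj},q_{Dj}$ are the active (known) and reactive (controllable) outputs of the distributed energy resource (DER) of rating $S_{DRj}$ at node $j$. $I_{ij}^{\mathrm{rated}}$ is the thermal rating of line $(i,j)$; $\underline V=0.95$ and $\overline V=1.05$. A superscript $(t)$ denotes the value at iteration step $t$. Algorithm. In ENDiCo-OPF, at step $t$ node $j$ receives $v_i^{(t-1)}$ from its parent $i$ and $P_{jk}^{(t-1)},Q_{jk}^{(t-1)}$ from its child $k$. Treating these as constants, it minimizes its local cost $r_{ij}\ell_{ij}^{(t)}$ subject to the power flow equations of line $(i,j)$ and the variable bounds, sets $q_{Dj}^{(t)}$ to the optimal value, and passes $v_j^{(t)}$ to its child and $P_{ij}^{(t)},Q_{ij}^{(t)}$ to its parent. $\Delta$-ENDiCo-OPF additionally maintains parameters $\Delta^{(t)}\ge1$, with $\Delta^{(0)}>1$ chosen by the user. At the end of step $t$: if $v_j^{(t)}=v_j^{(t-1)}$, stop; else if $\frac1{\Delta^{(t)}}v_j^{(t-1)}\le v_j^{(t)}\le\Delta^{(t)}v_j^{(t-1)}$, set $\Delta^{(t+1)}=1+\frac{\Delta^{(t)}-1}{2}$; otherwise set $\Delta^{(t+1)}=2\Delta^{(t)}-1$.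 Problem (S) for a local subsystem $\{i,j,k\}$ at step $t$. Minimize $r_{ij}\ell_{ij}^{(t)}+r_{ij}\ell_{ij}^{(t+1)}+r_{jk}\ell_{jk}^{(t)}$ over the 15 variables $P_{ij}^{(t)},Q_{ij}^{(t)},v_j^{(t)},\ell_{ij}^{(t)},q_{Dj}^{(t)},\ P_{jk}^{(t)},Q_{jk}^{(t)},v_k^{(t)},\ell_{jk}^{(t)},q_{Dk}^{(t)},\ P_{ij}^{(t+1)},Q_{ij}^{(t+1)},v_j^{(t+1)},\ell_{ij}^{(t+1)},q_{Dj}^{(t+1)}$ (collected in a vector $\mathbf z_j$) subject to the following. (a) Step $t$: $-r_{ij}\ell_{ij}^{(t)}=P_{jk}^{(t-1)}-P_{ij}^{(t)}+p_{Lj}^{(t)}-p_{Dj}^{(t)}$; $-x_{ij}\ell_{ij}^{(t)}=Q_{jk}^{(t-1)}-Q_{ij}^{(t)}+q_{Lj}^{(t)}-q_{Dj}^{(t)}$; $v_j^{(t)}=v_i^{(t-1)}-2(r_{ij}P_{ij}^{(t)}+x_{ij}Q_{ij}^{(t)})+(r_{ij}^2+x_{ij}^2)\ell_{ij}^{(t)}$; $\ell_{ij}^{(t)}=\big((P_{ij}^{(t)})^2+(Q_{ij}^{(t)})^2\big)/v_i^{(t-1)}$. (b) Line $(j,k)$: $-r_{jk}\ell_{jk}^{(t)}=-P_{jk}^{(t)}+p_{Lk}^{(t)}-p_{Dk}^{(t)}$; $-x_{jk}\ell_{jk}^{(t)}=-Q_{jk}^{(t)}+q_{Lk}^{(t)}-q_{Dk}^{(t)}$;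 $v_k^{(t)}=v_j^{(t-1)}-2(r_{jk}P_{jk}^{(t)}+x_{jk}Q_{jk}^{(t)})+(r_{jk}^2+x_{jk}^2)\ell_{jk}^{(t)}$; $\ell_{jk}^{(t)}=\big((P_{jk}^{(t)})^2+(Q_{jk}^{(t)})^2\big)/v_j^{(t-1)}$. (c) Step $t+1$: $-r_{ij}\ell_{ij}^{(t+1)}=P_{jk}^{(t)}-P_{ij}^{(t+1)}+p_{Lj}^{(t+1)}-p_{Dj}^{(t+1)}$; $-x_{ij}\ell_{ij}^{(t+1)}=Q_{jk}^{(t)}-Q_{ij}^{(t+1)}+q_{Lj}^{(t+1)}-q_{Dj}^{(t+1)}$; $v_j^{(t+1)}=v_i^{(t)}-2(r_{ij}P_{ij}^{(t+1)}+x_{ij}Q_{ij}^{(t+1)})+(r_{ij}^2+x_{ij}^2)\ell_{ij}^{(t+1)}$; $\ell_{ij}^{(t+1)}=\big((P_{ij}^{(t+1)})^2+(Q_{ij}^{(t+1)})^2\big)/v_i^{(t)}$. (d) $\frac1{\Delta^{(t+1)}}v_j^{(t)}\le v_j^{(t+1)}\le\Delta^{(t+1)}v_j^{(t)}$. (e) Bounds: $\underline V^2\le v_i^{(t)},v_j^{(t)},v_k^{(t)},v_j^{(t+1)}\le\overline V^2$; $|q_{Dj}^{(t)}|,|q_{Dj}^{(t+1)}|\le\sqrt{S_{DRj}^2-p_{Dj}^2}$; $|q_{Dk}^{(t)}|\le\sqrt{S_{DRk}^2-p_{Dk}^2}$; $\ell_{ij}^{(t)},\ell_{ij}^{(t+1)}\le(I_{ij}^{\mathrm{rated}})^2$;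 $\ell_{jk}^{(t)}\le(I_{jk}^{\mathrm{rated}})^2$. The quantities appearing in conditions (1)–(12) are the values at the solution of (S) (for $\{i,i+1,i+2\}$ at step $t_i$) together with the fixed data. Convergence of a local subsystem. $\{i,j,k\}$ converges at iteration step $t$ if the solution $\mathbf z_j^*$ of (S) is a strict local minimum of the objective of (S) subject to its constraints and $v_j^{(t)}=v_j^{(t-1)}$. Convergence-preservation assumption. Given two adjacent overlapping local subsystems $\{i,i+1,i+2\}$ and $\{i+1,i+2,i+3\}$ of the line network, where the first is convergent at iteration step $t_i$, the convergence of the controllable node $i+1$ is preserved in the next iteration step $t_{i+1}\ge t_i+1$ for the second subsystem (so node $i+1$ can be treated as a fixed source node for the second subsystem). Global convergence of the line system. The local subsystems $\{1,2,3\},\{2,3,4\},\dots,\{n-2,n-1,n\}$ converge in sequence, with $\{i,i+1,i+2\}$ converging at iteration step $t_i$. *)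

theory Defs
  imports "HOL-Analysis.Analysis"
begin

section \<open>Line network and operating data\<close>

text \<open>
  Nodes are numbered along the line, so the line \<open>(i, i+1)\<close> is indexed by its sending node
  \<open>i\<close>. Loads and active DER outputs carry a node and an iteration step.
\<close>

record network =
  res :: "nat \<Rightarrow> real"             (* r of line (i, i+1) *)
  rea :: "nat \<Rightarrow> real"             (* x of line (i, i+1) *)
  Irated :: "nat \<Rightarrow> real"          (* thermal rating of line (i, i+1) *)
  pL :: "nat \<Rightarrow> nat \<Rightarrow> real"      (* active load: node, step *)
  qL :: "nat \<Rightarrow> nat \<Rightarrow> real"      (* reactive load: node, step *)
  pD :: "nat \<Rightarrow> nat \<Rightarrow> real"      (* active DER output: node, step *)
  SDR :: "nat \<Rightarrow> real"             (* DER rating at a node *)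

definition Vmin :: real where "Vmin = 95 / 100"
definition Vmax :: real where "Vmax = 105 / 100"

text \<open>
  The variables of one line at one step: \<open>(P, Q, v, l, q)\<close>, where \<open>P\<close>, \<open>Q\<close>, \<open>l\<close> belong to
  the line and \<open>v\<close>, \<open>q\<close> are the squared voltage and the reactive DER output at its receiving node.
\<close>

type_synonym line_vars = "real \<times> real \<times> real \<times> real \<times> real"

fun actP :: "line_vars \<Rightarrow> real" where "actP (P, Q, v, l, q) = P"
fun reaQ :: "line_vars \<Rightarrow> real" where "reaQ (P, Q, v, l, q) = Q"
fun volt :: "line_vars \<Rightarrow> real" where "volt (P, Q, v, l, q) = v"
fun curr :: "line_vars \<Rightarrow> real" where "curr (P, Q, v, l, q) = l"
fun derq :: "line_vars \<Rightarrow> real" where "derq (P, Q, v, l, q) = q"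

text \<open>
  Power flow equations of line \<open>(i, i+1)\<close> at step \<open>t\<close>, for a given sending-end squared voltage
  \<open>vs\<close> and given flows \<open>Pd\<close>, \<open>Qd\<close> leaving the receiving node downstream (zero at a leaf).
\<close>

fun power_flow ::
  "network \<Rightarrow> nat \<Rightarrow> nat \<Rightarrow> real \<Rightarrow> real \<Rightarrow> real \<Rightarrow> line_vars \<Rightarrow> bool" where
  "power_flow N i t vs Pd Qd (P, Q, v, l, q) \<longleftrightarrow>
     - (res N i * l) = Pd - P + pL N (i+1) t - pD N (i+1) t \<and>
     - (rea N i * l) = Qd - Q + qL N (i+1) t - q \<and>
     v = vs - 2 * (res N i * P + rea N i * Q) + ((res N i)\<^sup>2 + (rea N i)\<^sup>2) * l \<and>
     l = (P\<^sup>2 + Q\<^sup>2) / vs"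

definition volt_ok :: "real \<Rightarrow> bool" where
  "volt_ok v \<longleftrightarrow> Vmin\<^sup>2 \<le> v \<and> v \<le> Vmax\<^sup>2"

fun var_bounds :: "network \<Rightarrow> nat \<Rightarrow> nat \<Rightarrow> line_vars \<Rightarrow> bool" where
  "var_bounds N i t (P, Q, v, l, q) \<longleftrightarrow>
     volt_ok v \<and>
     \<bar>q\<bar> \<le> sqrt ((SDR N (i+1))\<^sup>2 - (pD N (i+1) t)\<^sup>2) \<and>
     l \<le> (Irated N i)\<^sup>2"

text \<open>The test that compares two successive squared voltages \<open>v\<close>, \<open>v'\<close> for a parameter \<open>d\<close>.\<close>

definition delta_window :: "real \<Rightarrow> real \<Rightarrow> real \<Rightarrow> bool" where
  "delta_window d v v' \<longleftrightarrow> 1 / d * v \<le> v' \<and> v' \<le> d * v"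

section \<open>The algorithm\<close>

text \<open>
  Iterates. \<open>vm\<close>, \<open>qd\<close>, \<open>Dl\<close> (the parameter \<open>\<Delta>\<close>) are indexed by node and step; each local
  subsystem has its own \<open>\<Delta>\<close>, attached to its middle node, because the update rule depends on that
  node's voltage only. \<open>fP\<close>, \<open>fQ\<close>, \<open>ell\<close> are indexed by line and step.
\<close>

record iterates =
  vm :: "nat \<Rightarrow> nat \<Rightarrow> real"
  qd :: "nat \<Rightarrow> nat \<Rightarrow> real"
  fP :: "nat \<Rightarrow> nat \<Rightarrow> real"
  fQ :: "nat \<Rightarrow> nat \<Rightarrow> real"
  ell :: "nat \<Rightarrow> nat \<Rightarrow> real"
  Dl :: "nat \<Rightarrow> nat \<Rightarrow> real"

definition line_iterate :: "iterates \<Rightarrow> nat \<Rightarrow> nat \<Rightarrow> line_vars" where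
  "line_iterate X i t = (fP X i t, fQ X i t, vm X (i+1) t, ell X i t, qd X (i+1) t)"

text \<open>
  The single-step problem that node \<open>i+1\<close> solves at step \<open>t\<close>, with the data received from its
  parent and its child at step \<open>t-1\<close>; the leaf \<open>n\<close> has no child.
\<close>

definition local_feasible ::
  "network \<Rightarrow> nat \<Rightarrow> iterates \<Rightarrow> nat \<Rightarrow> nat \<Rightarrow> line_vars \<Rightarrow> bool" where
  "local_feasible N n X i t y \<longleftrightarrow>
     power_flow N i t (vm X i (t-1))
       (if i + 1 = n then 0 else fP X (i+1) (t-1))
       (if i + 1 = n then 0 else fQ X (i+1) (t-1)) y \<and>
     var_bounds N i t y"

definition stopped :: "iterates \<Rightarrow> nat \<Rightarrow> nat \<Rightarrow> bool" where
  "stopped X j t \<longleftrightarrow> (\<exists>\<tau>\<in>{1..t}. vm X j \<tau> = vm X j (\<tau> - 1))"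

text \<open>
  Once a node has stopped, the algorithm imposes nothing further on its iterates. The source node
  \<open>1\<close> has a fixed voltage.
\<close>

definition delta_endico :: "network \<Rightarrow> nat \<Rightarrow> iterates \<Rightarrow> bool" where
  "delta_endico N n X \<longleftrightarrow>
     (\<forall>t. vm X 1 t = vm X 1 0) \<and>
     (\<forall>i\<in>{1..n-1}. \<forall>t\<ge>1. \<not> stopped X (i+1) (t-1) \<longrightarrow>
        is_arg_min (\<lambda>y. res N i * curr y) (local_feasible N n X i t) (line_iterate X i t)) \<and>
     (\<forall>j\<in>{2..n-1}.
        Dl X j 0 > 1 \<and> (\<forall>t. Dl X j t \<ge> 1) \<and>
        (\<forall>t\<ge>1. \<not> stopped X j t \<longrightarrow>
           Dl X j (t+1) =
             (if delta_window (Dl X j t) (vm X j (t-1)) (vm X j t)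
              then 1 + (Dl X j t - 1) / 2
              else 2 * Dl X j t - 1)))"

section \<open>The two-step problem of a local subsystem\<close>

text \<open>
  The 15 variables for the subsystem \<open>{i, i+1, i+2}\<close> at step \<open>t\<close>: line \<open>(i, i+1)\<close> at step \<open>t\<close>,
  line \<open>(i+1, i+2)\<close> at step \<open>t\<close>, and line \<open>(i, i+1)\<close> at step \<open>t+1\<close>. The product type carries the
  Euclidean metric.
\<close>

type_synonym sub_vars = "line_vars \<times> line_vars \<times> line_vars"

text \<open>
  All other quantities, namely the voltages of \<open>i\<close> at steps \<open>t-1\<close> and \<open>t\<close>, the voltage of \<open>i+1\<close>
  and the flow on \<open>(i+1, i+2)\<close> at step \<open>t-1\<close>, and \<open>\<Delta>\<close> at step \<open>t+1\<close>, are data taken from the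
  iterates.
\<close>

fun S_feasible :: "network \<Rightarrow> iterates \<Rightarrow> nat \<Rightarrow> nat \<Rightarrow> sub_vars \<Rightarrow> bool" where
  "S_feasible N X i t (a, b, c) \<longleftrightarrow>
     power_flow N i t (vm X i (t-1)) (fP X (i+1) (t-1)) (fQ X (i+1) (t-1)) a \<and>
     power_flow N (i+1) t (vm X (i+1) (t-1)) 0 0 b \<and>
     power_flow N i (t+1) (vm X i t) (actP b) (reaQ b) c \<and>
     delta_window (Dl X (i+1) (t+1)) (volt a) (volt c) \<and>
     volt_ok (vm X i t) \<and>
     var_bounds N i t a \<and> var_bounds N (i+1) t b \<and> var_bounds N i (t+1) c"

fun S_objective :: "network \<Rightarrow> nat \<Rightarrow> sub_vars \<Rightarrow> real" where
  "S_objective N i (a, b, c) = res N i * curr a + res N i * curr c + res N (i+1) * curr b"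

definition S_solution :: "network \<Rightarrow> iterates \<Rightarrow> nat \<Rightarrow> nat \<Rightarrow> sub_vars \<Rightarrow> bool" where
  "S_solution N X i t z \<longleftrightarrow> is_arg_min (S_objective N i) (S_feasible N X i t) z"

section \<open>Convergence\<close>

definition strict_local_min ::
  "('a::topological_space \<Rightarrow> real) \<Rightarrow> ('a \<Rightarrow> bool) \<Rightarrow> 'a \<Rightarrow> bool" where
  "strict_local_min f F z \<longleftrightarrow> F z \<and> (\<forall>\<^sub>F y in at z within {y. F y}. f z < f y)"

definition subsystem_converges :: "network \<Rightarrow> iterates \<Rightarrow> nat \<Rightarrow> nat \<Rightarrow> sub_vars \<Rightarrow> bool" where
  "subsystem_converges N X i t z \<longleftrightarrow>
     S_solution N X i t z \<and>
     strict_local_min (S_objective N i) (S_feasible N X i t) z \<and>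
     volt (fst z) = vm X (i+1) (t-1)"

text \<open>
  If \<open>{i, i+1, i+2}\<close> converges at step \<open>t i\<close>, then node \<open>i+1\<close> keeps its converged voltage at the
  two steps at which it enters, as sending node, the problem of \<open>{i+1, i+2, i+3}\<close> at \<open>t (i+1)\<close>.
\<close>

definition convergence_preserved ::
  "network \<Rightarrow> nat \<Rightarrow> iterates \<Rightarrow> (nat \<Rightarrow> nat) \<Rightarrow> (nat \<Rightarrow> sub_vars) \<Rightarrow> bool" where
  "convergence_preserved N n X t z \<longleftrightarrow>
     (\<forall>i\<in>{1..n-3}. t i + 1 \<le> t (i+1) \<longrightarrow> subsystem_converges N X i (t i) (z i) \<longrightarrow>
        vm X (i+1) (t (i+1) - 1) = volt (fst (z i)) \<and>
        vm X (i+1) (t (i+1)) = volt (fst (z i)))"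

definition globally_converges ::
  "network \<Rightarrow> nat \<Rightarrow> iterates \<Rightarrow> (nat \<Rightarrow> nat) \<Rightarrow> (nat \<Rightarrow> sub_vars) \<Rightarrow> bool" where
  "globally_converges N n X t z \<longleftrightarrow>
     (\<forall>i\<in>{1..n-3}. t i + 1 \<le> t (i+1)) \<and>
     (\<forall>i\<in>{1..n-2}. subsystem_converges N X i (t i) (z i))"

section \<open>The sufficient conditions\<close>

text \<open>
  The test at parameter value \<open>1\<close>. It is not stated as an equation for the algorithm's parameter
  \<open>Dl\<close>: starting above \<open>1\<close>, both update rules keep that parameter strictly above \<open>1\<close>. The equation \<open>Dl X (i+1) s = 1\<close>
  together with the test for \<open>Dl X (i+1) s\<close> implies the present form.
\<close>

definition unit_delta_condition ::
  "iterates \<Rightarrow> nat \<Rightarrow> nat \<Rightarrow> sub_vars \<Rightarrow> bool" where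
  "unit_delta_condition X i s z \<longleftrightarrow> delta_window 1 (vm X (i+1) (s-1)) (volt (fst z))"

definition sub_conditions :: "network \<Rightarrow> iterates \<Rightarrow> nat \<Rightarrow> nat \<Rightarrow> sub_vars \<Rightarrow> bool" where
  "sub_conditions N X i s z \<longleftrightarrow>
    (case z of (a, b, c) \<Rightarrow>
     (let rij = res N i; xij = rea N i; rjk = res N (i+1);
          vi = vm X i (s-1); vj = vm X (i+1) (s-1);
          P = actP a; Q = reaQ a; Pjk = actP b; P' = actP c
      in
        xij - rij \<ge> 0 \<and>
        vi * vj - 4 * P' * rij * vj - 4 * Pjk * rjk * vi \<ge> 0 \<and>
        vi * vj - 4 * P * rij * vj - 4 * Pjk * rjk * vi \<ge> 0 \<and>
        vi - 4 * P' * rij - 4 * P * rij \<ge> 0 \<and>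
        vi - 4 * P' * rij - 2 * P * rij - 2 * P * xij \<ge> 0 \<and>
        vi - 4 * P * rij - 4 * P * xij \<ge> 0 \<and>
        vi - P' * rij - Pjk * rjk \<ge> 0 \<and>
        vi * vj - 4 * Pjk * rjk * vi - 2 * P * rij * vj - 2 * P * xij * vj \<ge> 0 \<and>
        vj ^ 3 - 4 * P' * rij * vi * vj - 2 * Pjk * rjk * vi - 4 * P' * rij \<ge> 0 \<and>
        vi - 8 * P * rij \<ge> 0 \<and>
        vi - 8 * Q * xij \<ge> 0 \<and>
        vi - 8 * Pjk * rjk \<ge> 0))"

end

theory Submission
  imports Defs "HOL-Computational_Algebra.Polynomial"
begin

text \<open>
  Along feasible points the objective equals \<open>P\<^sub>i\<^sub>j(s) + P\<^sub>i\<^sub>j(s+1)\<close> up to a constant, since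
  \<open>r \<ell>\<close> is the active power lost on a line. The minimizers of the two-step problem are shown to
  be finitely many, so each of them is a strict local minimum.

  Preservation gives node \<open>i\<close> the same voltage \<open>v\<close> at steps \<open>s-1\<close> and \<open>s\<close>, so the solutions
  \<open>(P, Q)\<close> of the power flow on line \<open>(i, j)\<close> at step \<open>s\<close> form a circle. Rotating \<open>(P, Q)\<close> on it
  decreases the objective unless a constraint of that line or the window is active; rotating the
  step \<open>s+1\<close> flow along a level circle of \<open>v\<^sub>j(s+1)\<close> decreases it unless a constraint of line
  \<open>(j, k)\<close>, the DER bound or the thermal bound is active, or the flow is at the extreme point of
  that circle. In each combination the equations cut out a finite set. With an active window this
  could fail only if \<open>P\<^sub>i\<^sub>j(s) + P\<^sub>i\<^sub>j(s+1)\<close> equals \<open>v / r\<close> or \<open>v / (2 r)\<close>, because a circle would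
  then be mapped affinely onto a circle; condition (4) excludes both values.
\<close>

section \<open>Finiteness on a circle\<close>


lemma finite_square_eq: "finite {y::real. y\<^sup>2 = d}"
proof -
  have "{y. y\<^sup>2 = d} \<subseteq> {sqrt d, - sqrt d}"
    by (auto simp: real_sqrt_abs abs_if)
  then show ?thesis by (rule finite_subset) simp
qed

text \<open>Eliminating \<open>Q\<close> gives \<open>e\<^sup>2 = g h\<^sup>2\<close> with \<open>g = b + a P - P\<^sup>2\<close>. This cannot hold identically,
  since the leading coefficients of the two sides have opposite signs.\<close>

lemma finite_circle_zeros:
  fixes e h :: "real poly"
  assumes "e \<noteq> 0 \<or> h \<noteq> 0"
  shows "finite {(P, Q). P\<^sup>2 + Q\<^sup>2 = a * P + b \<and> poly e P + Q * poly h P = 0}"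
    (is "finite ?S")
proof -
  define g where "g = [:b, a, -1:]"
  define p where "p = e\<^sup>2 - g * h\<^sup>2"
  have "p \<noteq> 0"
  proof
    assume "p = 0"
    then have eq: "e\<^sup>2 = g * h\<^sup>2" by (simp add: p_def)
    have "lead_coeff g = -1" by (simp add: g_def)
    then have "(lead_coeff e)\<^sup>2 = - (lead_coeff h)\<^sup>2"
      using arg_cong[OF eq, of lead_coeff] by (simp add: lead_coeff_mult lead_coeff_power)
    then have "(lead_coeff e)\<^sup>2 + (lead_coeff h)\<^sup>2 = 0" by simp
    with assms show False by (simp add: sum_power2_eq_zero_iff)
  qed
  then have fin: "finite {P. poly p P = 0}" by (rule poly_roots_finite)
  have "?S \<subseteq> (\<Union>P\<in>{P. poly p P = 0}. Pair P ` {Q. Q\<^sup>2 = a * P + b - P\<^sup>2})"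
  proof clarify
    fix P Q assume c: "P\<^sup>2 + Q\<^sup>2 = a * P + b" and z: "poly e P + Q * poly h P = 0"
    have "(poly e P)\<^sup>2 = Q\<^sup>2 * (poly h P)\<^sup>2"
      using z by (metis eq_neg_iff_add_eq_0 power2_minus power_mult_distrib)
    moreover have "Q\<^sup>2 = poly g P" using c by (simp add: g_def power2_eq_square algebra_simps)
    ultimately have "poly p P = 0" by (simp add: p_def)
    moreover have "Q\<^sup>2 = a * P + b - P\<^sup>2" using c by simp
    ultimately show "(P, Q) \<in> (\<Union>P\<in>{P. poly p P = 0}. Pair P ` {Q. Q\<^sup>2 = a * P + b - P\<^sup>2})" by auto
  qed
  then show ?thesis
    by (rule finite_subset) (simp add: fin finite_square_eq)
qed

text \<open>Replacing \<open>Q\<^sup>2\<close> by \<open>a * P + b - P\<^sup>2\<close> makes the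
  second equation linear in \<open>Q\<close>, with coefficients \<open>e\<close> and
  \<open>h\<close>. Both vanish only if \<open>m = k = 0\<close>, \<open>\<kappa> = 1\<close> and
  \<open>a = f1 + 2 * c\<close>, which the second assumption excludes.\<close>

lemma finite_circle_inter_circle:
  fixes \<kappa> :: real
  assumes "\<kappa> > 0" "f1 + 2 * c \<noteq> a"
  shows "finite {(P, Q). P\<^sup>2 + Q\<^sup>2 = a * P + b \<and> (c - P)\<^sup>2 + (\<kappa> * Q + m * P + k)\<^sup>2 = f1 * P + f0}"
proof -
  define e where "e = [:c\<^sup>2 + k\<^sup>2 + \<kappa>\<^sup>2 * b - f0, \<kappa>\<^sup>2 * a + 2 * m * k - 2 * c - f1, 1 + m\<^sup>2 - \<kappa>\<^sup>2:]"
  define h where "h = [:2 * \<kappa> * k, 2 * \<kappa> * m:]"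
  have "e \<noteq> 0 \<or> h \<noteq> 0"
  proof (rule ccontr)
    assume "\<not> ?thesis"
    then have "m = 0" "k = 0" and e: "e = 0" using assms by (auto simp: h_def)
    then have "\<kappa>\<^sup>2 = 1" "\<kappa>\<^sup>2 * a = 2 * c + f1" by (auto simp: e_def)
    with assms show False by simp
  qed
  then have "finite {(P, Q). P\<^sup>2 + Q\<^sup>2 = a * P + b \<and> poly e P + Q * poly h P = 0}"
    by (rule finite_circle_zeros)
  moreover have "poly e P + Q * poly h P = 0"
    if "P\<^sup>2 + Q\<^sup>2 = a * P + b" "(c - P)\<^sup>2 + (\<kappa> * Q + m * P + k)\<^sup>2 = f1 * P + f0" for P Q
    using that unfolding e_def h_def poly_pCons poly_0 by algebra
  ultimately show ?thesis by (elim finite_subset[rotated]) auto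
qed

text \<open>The excluded case is the one where the two top coefficients below vanish: at the points
  \<open>Q = \<i> P\<close> at infinity they are the real and imaginary part of
  \<open>(l1 + \<i> l2)\<^sup>2 (4 x\<^sup>2 + (m1 + \<i> m2)\<^sup>2)\<close>.\<close>

lemma finite_circle_rational_generic:
  fixes x v :: real
  assumes "x \<noteq> 0" "l2 \<noteq> 0" "\<not> (m1 = 0 \<and> m2\<^sup>2 = 4 * x\<^sup>2)"
  shows "finite {(P, Q). P\<^sup>2 + Q\<^sup>2 = a * P + b \<and> (\<exists>\<sigma>.
      \<sigma> * (l0 + l1 * P + l2 * Q) = k0 + k1 * P + k2 * Q \<and>
      4 * x\<^sup>2 * (c - P)\<^sup>2 + (D * \<sigma> + m0 + m1 * P + m2 * Q)\<^sup>2 = 4 * x\<^sup>2 * v * \<sigma>)}"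
proof -
  define g where "g = [:b, a, -1:]"
  define L where "L = [:l0, l1:]"
  define K where "K = [:k0, k1:]"
  \<comment> \<open>\<open>J0 + Q * J1\<close> is \<open>D * \<sigma> + m0 + m1 * P + m2 * Q\<close>
    multiplied by the denominator of \<open>\<sigma>\<close>, with \<open>Q\<^sup>2\<close> replaced
    by \<open>g\<close>. In the same way \<open>e + Q * h\<close> is the last equation times the
    squared denominator.\<close>
  define J0 where "J0 = smult D K + [:m0, m1:] * L + smult (m2 * l2) g"
  define J1 where "J1 = [:D * k2:] + smult m2 L + smult l2 [:m0, m1:]"
  define e where "e = smult (4 * x\<^sup>2) ([:c, -1:]\<^sup>2 * (L\<^sup>2 + smult (l2\<^sup>2) g)) + (J0\<^sup>2 + g * J1\<^sup>2)
      - smult (4 * x\<^sup>2 * v) (K * L + smult (k2 * l2) g)"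
  define h where "h = smult (4 * x\<^sup>2) ([:c, -1:]\<^sup>2 * smult (2 * l2) L) + smult 2 (J0 * J1)
      - smult (4 * x\<^sup>2 * v) (smult k2 L + smult l2 K)"
  have e4: "coeff e 4 = 4 * x\<^sup>2 * (l1\<^sup>2 - l2\<^sup>2) + ((m1 * l1 - m2 * l2)\<^sup>2 - (m2 * l1 + l2 * m1)\<^sup>2)"
    by (simp add: e_def J0_def J1_def L_def K_def g_def numeral_eq_Suc power2_eq_square algebra_simps)
  have h3: "coeff h 3 = 4 * x\<^sup>2 * 2 * l1 * l2 + 2 * (m1 * l1 - m2 * l2) * (m2 * l1 + l2 * m1)"
    by (simp add: h_def J0_def J1_def L_def K_def g_def numeral_eq_Suc power2_eq_square algebra_simps)
  have "e \<noteq> 0 \<or> h \<noteq> 0"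
  proof (rule ccontr)
    assume "\<not> ?thesis"
    then have "e = 0" "h = 0" by auto
    then have E: "4 * x\<^sup>2 * (l1\<^sup>2 - l2\<^sup>2) + ((m1 * l1 - m2 * l2)\<^sup>2 - (m2 * l1 + l2 * m1)\<^sup>2) = 0"
      and H: "4 * x\<^sup>2 * 2 * l1 * l2 + 2 * (m1 * l1 - m2 * l2) * (m2 * l1 + l2 * m1) = 0"
      using e4 h3 by auto
    \<comment> \<open>\<open>p + \<i> q = (l1 + \<i> l2)\<^sup>2\<close> and
      \<open>X + \<i> Y = 4 x\<^sup>2 + (m1 + \<i> m2)\<^sup>2\<close>. Their product is zero and
      the first factor is not, so the second one is.\<close>
    define X where "X = 4 * x\<^sup>2 + m1\<^sup>2 - m2\<^sup>2"
    define Y where "Y = 2 * m1 * m2"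
    define p where "p = l1\<^sup>2 - l2\<^sup>2"
    define q where "q = 2 * l1 * l2"
    have "p * X - q * Y = 0" using E unfolding X_def Y_def p_def q_def by algebra
    moreover have "p * Y + q * X = 0" using H unfolding X_def Y_def p_def q_def by algebra
    ultimately have "(p\<^sup>2 + q\<^sup>2) * X = 0" "(p\<^sup>2 + q\<^sup>2) * Y = 0" by algebra+
    moreover have "p\<^sup>2 + q\<^sup>2 = (l1\<^sup>2 + l2\<^sup>2)\<^sup>2" unfolding p_def q_def by algebra
    moreover have "l1\<^sup>2 + l2\<^sup>2 \<noteq> 0" using assms by (simp add: sum_power2_eq_zero_iff)
    ultimately have X: "X = 0" and Y: "Y = 0" by auto
    from Y have "m1 = 0 \<or> m2 = 0" by (simp add: Y_def)
    moreover have "m2 \<noteq> 0"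
    proof
      assume "m2 = 0"
      with X have "4 * x\<^sup>2 + m1\<^sup>2 = 0" by (simp add: X_def)
      moreover have "x\<^sup>2 > 0" using assms(1) by simp
      ultimately show False using zero_le_power2[of m1] by linarith
    qed
    ultimately show False using X assms(3) by (simp add: X_def)
  qed
  then have "finite {(P, Q). P\<^sup>2 + Q\<^sup>2 = a * P + b \<and> poly e P + Q * poly h P = 0}"
    by (rule finite_circle_zeros)
  moreover have "poly e P + Q * poly h P = 0"
    if circ: "P\<^sup>2 + Q\<^sup>2 = a * P + b" and \<sigma>: "\<sigma> * (l0 + l1 * P + l2 * Q) = k0 + k1 * P + k2 * Q"
      and s: "4 * x\<^sup>2 * (c - P)\<^sup>2 + (D * \<sigma> + m0 + m1 * P + m2 * Q)\<^sup>2 = 4 * x\<^sup>2 * v * \<sigma>" for P Q \<sigma>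
  proof -
    define l where "l = l0 + l1 * P + l2 * Q"
    define k where "k = k0 + k1 * P + k2 * Q"
    define j where "j = D * k + (m0 + m1 * P + m2 * Q) * l"
    have g: "poly g P = Q\<^sup>2" using circ by (simp add: g_def power2_eq_square algebra_simps)
    have j: "poly J0 P + Q * poly J1 P = j"
      unfolding J0_def J1_def L_def K_def poly_add poly_mult poly_smult g j_def l_def k_def
      by (simp add: algebra_simps power2_eq_square)
    have "poly e P + Q * poly h P
        = 4 * x\<^sup>2 * (c - P)\<^sup>2 * l\<^sup>2 + (poly J0 P + Q * poly J1 P)\<^sup>2 - 4 * x\<^sup>2 * v * (k * l)"
      unfolding e_def h_def poly_add poly_diff poly_mult poly_smult poly_power g L_def K_def l_def k_def
      by (simp add: algebra_simps power2_eq_square)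
    also have "\<dots> = 4 * x\<^sup>2 * (c - P)\<^sup>2 * l\<^sup>2 + j\<^sup>2 - 4 * x\<^sup>2 * v * (k * l)" by (simp only: j)
    also have "\<dots> = 0"
      using s \<sigma> unfolding j_def l_def[symmetric] k_def[symmetric] by algebra
    finally show ?thesis .
  qed
  ultimately show ?thesis by (elim finite_subset[rotated]) auto
qed

text \<open>Both equations are linear in \<open>(P, Q)\<close> for fixed \<open>\<delta>\<close>. Cramer's rule turns the circle equation
  into a polynomial in \<open>\<delta>\<close> whose coefficient of degree \<open>6\<close> is a nonzero sum of squares.\<close>

lemma finite_circle_rational_special:
  fixes x :: real
  assumes "x \<noteq> 0" "w1 \<noteq> 0"
  shows "finite {(P, Q). P\<^sup>2 + Q\<^sup>2 = a * P + b \<and> (\<exists>\<delta>.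
      w1 * P + 2 * \<delta> * Q = - \<delta>\<^sup>2 + b1 * \<delta> + b0 \<and>
      \<delta> * (u1 * P - 2 * x * Q) + g1 * \<delta> + g2 * P + g3 * Q + g4 = 0)}"
    (is "finite ?S")
proof -
  define T where "T = [:b0, b1, -1:]"
  define Dt where "Dt = smult w1 [:g3, -2 * x:] - [:0, 2:] * [:g2, u1:]"
  define Pn where "Pn = T * [:g3, -2 * x:] + [:0, 2:] * [:g4, g1:]"
  define Qn where "Qn = - smult w1 [:g4, g1:] - T * [:g2, u1:]"
  define p where "p = Pn\<^sup>2 + Qn\<^sup>2 - smult a (Pn * Dt) - smult b (Dt\<^sup>2)"
  have "coeff p 6 = 4 * x\<^sup>2 + u1\<^sup>2"
    by (simp add: p_def Dt_def Pn_def Qn_def T_def numeral_eq_Suc power2_eq_square algebra_simps)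
  moreover have "4 * x\<^sup>2 + u1\<^sup>2 > 0" using assms by (simp add: add_pos_nonneg)
  ultimately have "p \<noteq> 0" by auto
  then have fin: "finite {\<delta>. poly p \<delta> = 0}" by (rule poly_roots_finite)
  \<comment> \<open>Where the determinant \<open>Dt\<close> vanishes, \<open>\<delta>\<close> does
    not determine \<open>(P, Q)\<close>. The first linear equation is still nontrivial because of
    \<open>w1\<close>, so it meets the circle in finitely many points.\<close>
  define F where "F \<delta> = {(P, Q). P\<^sup>2 + Q\<^sup>2 = a * P + b \<and>
      poly [:\<delta>\<^sup>2 - b1 * \<delta> - b0, w1:] P + Q * poly [:2 * \<delta>:] P = 0}" for \<delta>
  have "finite (F \<delta>)" for \<delta>
    unfolding F_def by (rule finite_circle_zeros) (simp add: assms)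
  moreover have "?S \<subseteq> (\<Union>\<delta>\<in>{\<delta>. poly p \<delta> = 0}. F \<delta>)"
  proof clarsimp
    fix P Q \<delta> assume circ: "P\<^sup>2 + Q\<^sup>2 = a * P + b"
      and 1: "w1 * P + 2 * \<delta> * Q = b1 * \<delta> - \<delta>\<^sup>2 + b0"
      and 2: "\<delta> * (u1 * P - 2 * x * Q) + g1 * \<delta> + g2 * P + g3 * Q + g4 = 0"
    have P: "poly Pn \<delta> = poly Dt \<delta> * P"
      unfolding Pn_def Dt_def T_def poly_add poly_diff poly_mult poly_smult poly_pCons poly_0
      using 1 2 by algebra
    have Q: "poly Qn \<delta> = poly Dt \<delta> * Q"
      unfolding Qn_def Dt_def T_def poly_add poly_diff poly_mult poly_smult poly_pCons poly_0 poly_minus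
      using 1 2 by algebra
    have "poly p \<delta> = 0"
      unfolding p_def poly_add poly_diff poly_mult poly_smult poly_power P Q using circ by algebra
    moreover have "(P, Q) \<in> F \<delta>" using 1 circ by (simp add: F_def algebra_simps)
    ultimately show "\<exists>\<delta>. poly p \<delta> = 0 \<and> (P, Q) \<in> F \<delta>" by blast
  qed
  ultimately show ?thesis using fin by (meson finite_UN_I finite_subset)
qed


text \<open>Here \<open>(c - P, Q')\<close> is the flow at step \<open>t+1\<close> and \<open>\<sigma>\<close> its squared current. The voltage ratio \<open>\<kappa>\<close>
  makes \<open>Q'\<close> affine in \<open>(P, Q, \<sigma>)\<close>, and by it the quadratic part of the last equation reduces
  to \<open>\<sigma>\<close> times an affine function of \<open>(P, Q)\<close>, so that \<open>\<sigma>\<close> is a rational function on the circle.\<close>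

lemma finite_volt_ratio_derq_active:
  fixes r x v \<kappa> :: real
  assumes "r > 0" "x > 0" "v > 0" "\<kappa> > 0" "2 * c \<noteq> v / r"
  shows "finite {(P, Q). P\<^sup>2 + Q\<^sup>2 = v / r * (P - A) \<and> (\<exists>Q' \<sigma>.
      v * \<sigma> = (c - P)\<^sup>2 + Q'\<^sup>2 \<and>
      v - 2 * r * (c - P) - 2 * x * Q' + (r\<^sup>2 + x\<^sup>2) * \<sigma>
        = \<kappa> * (v - 2 * r * P - 2 * x * Q + (r\<^sup>2 + x\<^sup>2) / v * (P\<^sup>2 + Q\<^sup>2)) \<and>
      (c - P - r * \<sigma> - A')\<^sup>2 + (Q' - x * \<sigma> + d)\<^sup>2 = w * (c - P - r * \<sigma> - A' - B))}"
    (is "finite ?S")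
proof -
  define D where "D = r\<^sup>2 + x\<^sup>2"
  \<comment> \<open>On the circle the voltage at \<open>j\<close> in step \<open>s\<close> is the
    affine function \<open>\<alpha> * P - 2 * x * Q + \<beta>\<close>.\<close>
  define \<alpha> where "\<alpha> = D / r - 2 * r"
  define \<beta> where "\<beta> = v - D / r * A"
  define m0 where "m0 = v - 2 * r * c - \<kappa> * \<beta>"
  define m1 where "m1 = 2 * r - \<kappa> * \<alpha>"
  define m2 where "m2 = 2 * x * \<kappa>"
  define g where "g = 2 * (A' * r - d * x) + w * r + d * D / x"
  have lin: "2 * x * Q' = D * \<sigma> + m0 + m1 * P + m2 * Q"
    "\<sigma> * (\<kappa> * (\<alpha> * P - 2 * x * Q + \<beta>) + g)
       = w * (c - P - A' - B) + 2 * A' * (c - P) - A'\<^sup>2 - d\<^sup>2 - d / x * (m0 + m1 * P + m2 * Q)"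
    "4 * x\<^sup>2 * (c - P)\<^sup>2 + (D * \<sigma> + m0 + m1 * P + m2 * Q)\<^sup>2 = 4 * x\<^sup>2 * v * \<sigma>"
    if circ: "P\<^sup>2 + Q\<^sup>2 = v / r * (P - A)" and 1: "v * \<sigma> = (c - P)\<^sup>2 + Q'\<^sup>2"
      and 2: "v - 2 * r * (c - P) - 2 * x * Q' + D * \<sigma>
        = \<kappa> * (v - 2 * r * P - 2 * x * Q + D / v * (P\<^sup>2 + Q\<^sup>2))"
      and 3: "(c - P - r * \<sigma> - A')\<^sup>2 + (Q' - x * \<sigma> + d)\<^sup>2 = w * (c - P - r * \<sigma> - A' - B)"
    for P Q Q' \<sigma>
  proof -
    have u: "v - 2 * r * P - 2 * x * Q + D / v * (P\<^sup>2 + Q\<^sup>2) = \<alpha> * P - 2 * x * Q + \<beta>"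
      using assms unfolding circ \<alpha>_def \<beta>_def by (simp add: field_simps)
    show *: "2 * x * Q' = D * \<sigma> + m0 + m1 * P + m2 * Q"
      using 2 unfolding u m0_def m1_def m2_def by (simp add: algebra_simps)
    have 4: "D * \<sigma> = 2 * r * (c - P) + 2 * x * Q' - v + \<kappa> * (\<alpha> * P - 2 * x * Q + \<beta>)"
      using 2 unfolding u by simp
    have "(c - P - r * \<sigma> - A')\<^sup>2 + (Q' - x * \<sigma> + d)\<^sup>2
       = (c - P)\<^sup>2 + Q'\<^sup>2 + \<sigma> * (D * \<sigma> - 2 * r * (c - P) - 2 * x * Q')
         - 2 * A' * (c - P) + 2 * d * Q' + 2 * \<sigma> * (A' * r - d * x) + A'\<^sup>2 + d\<^sup>2"
      unfolding D_def by algebra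
    also have "\<dots> = \<sigma> * \<kappa> * (\<alpha> * P - 2 * x * Q + \<beta>)
         - 2 * A' * (c - P) + 2 * d * Q' + 2 * \<sigma> * (A' * r - d * x) + A'\<^sup>2 + d\<^sup>2"
      unfolding 1[symmetric] 4 by algebra
    finally have "\<sigma> * \<kappa> * (\<alpha> * P - 2 * x * Q + \<beta>)
         - 2 * A' * (c - P) + 2 * d * Q' + 2 * \<sigma> * (A' * r - d * x) + A'\<^sup>2 + d\<^sup>2
         = w * (c - P - r * \<sigma> - A' - B)" using 3 by simp
    moreover have "2 * d * Q' = d / x * (D * \<sigma> + m0 + m1 * P + m2 * Q)"
      unfolding *[symmetric] using assms by simp
    ultimately show "\<sigma> * (\<kappa> * (\<alpha> * P - 2 * x * Q + \<beta>) + g)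
       = w * (c - P - A' - B) + 2 * A' * (c - P) - A'\<^sup>2 - d\<^sup>2 - d / x * (m0 + m1 * P + m2 * Q)"
      unfolding g_def by (simp add: algebra_simps)
    show "4 * x\<^sup>2 * (c - P)\<^sup>2 + (D * \<sigma> + m0 + m1 * P + m2 * Q)\<^sup>2 = 4 * x\<^sup>2 * v * \<sigma>"
      unfolding *[symmetric] using 1 by algebra
  qed
  show ?thesis
  proof (cases "m1 = 0 \<and> m2\<^sup>2 = 4 * x\<^sup>2")
    case False
    have "finite {(P, Q). P\<^sup>2 + Q\<^sup>2 = v / r * P + - (v / r * A) \<and> (\<exists>\<sigma>.
      \<sigma> * (\<kappa> * \<beta> + g + \<kappa> * \<alpha> * P + - (2 * x * \<kappa>) * Q)
        = w * (c - A' - B) + 2 * A' * c - A'\<^sup>2 - d\<^sup>2 - d / x * m0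
          + (- w - 2 * A' - d / x * m1) * P + (- (d / x * m2)) * Q \<and>
      4 * x\<^sup>2 * (c - P)\<^sup>2 + (D * \<sigma> + m0 + m1 * P + m2 * Q)\<^sup>2 = 4 * x\<^sup>2 * v * \<sigma>)}"
      using assms False by (intro finite_circle_rational_generic) auto
    moreover have "?S \<subseteq> \<dots>"
    proof clarify
      fix P Q Q' \<sigma>
      assume A: "P\<^sup>2 + Q\<^sup>2 = v / r * (P - A)" "v * \<sigma> = (c - P)\<^sup>2 + Q'\<^sup>2"
        "v - 2 * r * (c - P) - 2 * x * Q' + (r\<^sup>2 + x\<^sup>2) * \<sigma>
          = \<kappa> * (v - 2 * r * P - 2 * x * Q + (r\<^sup>2 + x\<^sup>2) / v * (P\<^sup>2 + Q\<^sup>2))"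
        "(c - P - r * \<sigma> - A')\<^sup>2 + (Q' - x * \<sigma> + d)\<^sup>2 = w * (c - P - r * \<sigma> - A' - B)"
      note l = lin[OF A[folded D_def]]
      have "P\<^sup>2 + Q\<^sup>2 = v / r * P + - (v / r * A)" using A(1) by (simp add: right_diff_distrib)
      moreover have "\<sigma> * (\<kappa> * \<beta> + g + \<kappa> * \<alpha> * P + - (2 * x * \<kappa>) * Q)
        = w * (c - A' - B) + 2 * A' * c - A'\<^sup>2 - d\<^sup>2 - d / x * m0
          + (- w - 2 * A' - d / x * m1) * P + (- (d / x * m2)) * Q"
        using l(2) by (simp add: algebra_simps)
      ultimately show "P\<^sup>2 + Q\<^sup>2 = v / r * P + - (v / r * A) \<and> (\<exists>\<sigma>.
        \<sigma> * (\<kappa> * \<beta> + g + \<kappa> * \<alpha> * P + - (2 * x * \<kappa>) * Q)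
        = w * (c - A' - B) + 2 * A' * c - A'\<^sup>2 - d\<^sup>2 - d / x * m0
          + (- w - 2 * A' - d / x * m1) * P + (- (d / x * m2)) * Q \<and>
        4 * x\<^sup>2 * (c - P)\<^sup>2 + (D * \<sigma> + m0 + m1 * P + m2 * Q)\<^sup>2 = 4 * x\<^sup>2 * v * \<sigma>)"
        using l(3) by blast
    qed
    ultimately show ?thesis by (rule finite_subset[rotated])
  next
    case True
    then have m1: "m1 = 0" and "(2 * x * \<kappa>)\<^sup>2 = (2 * x * 1)\<^sup>2" by (auto simp: m2_def power_mult_distrib)
    then have \<kappa>: "\<kappa> = 1" using assms by (simp add: power_mult_distrib power2_eq_1_iff)
    have m2: "m2 = 2 * x" using \<kappa> by (simp add: m2_def)
    have D: "D > 0" using assms by (simp add: D_def add_pos_pos)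
    define q0 where "q0 = m0 / (2 * x)"
    define n where "n = D / (2 * x)"
    have n: "n > 0" using D assms by (simp add: n_def)
    have "finite {(P, Q). P\<^sup>2 + Q\<^sup>2 = v / r * P + - (v / r * A) \<and> (\<exists>\<delta>.
      (v / r - 2 * c) * P + 2 * \<delta> * Q = - \<delta>\<^sup>2 + v / n * \<delta> + (- (v * q0 / n) - c\<^sup>2 + v / r * A) \<and>
      \<delta> * (\<alpha> * P - 2 * x * Q) + (\<beta> + g) * \<delta> + (n * (w + 2 * A') - q0 * \<alpha>) * P
        + (2 * n * d + 2 * x * q0) * Q
        + (- q0 * (\<beta> + g) - n * (w * (c - A' - B) + 2 * A' * c - A'\<^sup>2 - d\<^sup>2 - d / x * m0)) = 0)}"
      using assms by (intro finite_circle_rational_special) auto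
    moreover have "?S \<subseteq> \<dots>"
    proof clarify
      fix P Q Q' \<sigma>
      assume A: "P\<^sup>2 + Q\<^sup>2 = v / r * (P - A)" "v * \<sigma> = (c - P)\<^sup>2 + Q'\<^sup>2"
        "v - 2 * r * (c - P) - 2 * x * Q' + (r\<^sup>2 + x\<^sup>2) * \<sigma>
          = \<kappa> * (v - 2 * r * P - 2 * x * Q + (r\<^sup>2 + x\<^sup>2) / v * (P\<^sup>2 + Q\<^sup>2))"
        "(c - P - r * \<sigma> - A')\<^sup>2 + (Q' - x * \<sigma> + d)\<^sup>2 = w * (c - P - r * \<sigma> - A' - B)"
      note l = lin[OF A[folded D_def], unfolded m1 m2 \<kappa>]
      \<comment> \<open>For \<open>m1 = 0\<close> and \<open>\<kappa> = 1\<close> the difference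
        \<open>Q' - Q\<close> is affine in \<open>\<sigma>\<close> alone, so it replaces
        \<open>\<sigma>\<close> as parameter. Subtracting the two circle equations leaves
        \<open>P\<close> with the coefficient \<open>v / r - 2 * c\<close>, nonzero by
        assumption.\<close>
      define \<delta> where "\<delta> = Q' - Q"
      have "2 * x * (Q' - Q) = D * \<sigma> + m0" using l(1) by (simp add: algebra_simps)
      then have "\<delta> = n * \<sigma> + q0" using assms by (simp add: \<delta>_def n_def q0_def field_simps)
      then have \<sigma>: "\<sigma> = (\<delta> - q0) / n" using n by (simp add: field_simps)
      have "P\<^sup>2 + Q\<^sup>2 = v / r * P + - (v / r * A)" using A(1) by (simp add: right_diff_distrib)
      moreover have "(v / r - 2 * c) * P + 2 * \<delta> * Q = - \<delta>\<^sup>2 + v * \<sigma> - c\<^sup>2 + v / r * A"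
        using A(1,2) unfolding \<delta>_def by algebra
      then have "(v / r - 2 * c) * P + 2 * \<delta> * Q
          = - \<delta>\<^sup>2 + v / n * \<delta> + (- (v * q0 / n) - c\<^sup>2 + v / r * A)"
        unfolding \<sigma> by (simp add: diff_divide_distrib right_diff_distrib)
      moreover have "(\<delta> - q0) * (\<alpha> * P - 2 * x * Q + \<beta> + g)
          = n * (w * (c - P - A' - B) + 2 * A' * (c - P) - A'\<^sup>2 - d\<^sup>2 - d / x * (m0 + 2 * x * Q))"
        using l(2) n unfolding \<sigma> by (simp add: field_simps)
      then have "\<delta> * (\<alpha> * P - 2 * x * Q) + (\<beta> + g) * \<delta> + (n * (w + 2 * A') - q0 * \<alpha>) * P
        + (2 * n * d + 2 * x * q0) * Q
        + (- q0 * (\<beta> + g) - n * (w * (c - A' - B) + 2 * A' * c - A'\<^sup>2 - d\<^sup>2 - d / x * m0)) = 0"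
        using assms(2) by (simp add: algebra_simps)
      ultimately show "P\<^sup>2 + Q\<^sup>2 = v / r * P + - (v / r * A) \<and> (\<exists>\<delta>.
        (v / r - 2 * c) * P + 2 * \<delta> * Q = - \<delta>\<^sup>2 + v / n * \<delta> + (- (v * q0 / n) - c\<^sup>2 + v / r * A) \<and>
        \<delta> * (\<alpha> * P - 2 * x * Q) + (\<beta> + g) * \<delta> + (n * (w + 2 * A') - q0 * \<alpha>) * P
        + (2 * n * d + 2 * x * q0) * Q
        + (- q0 * (\<beta> + g) - n * (w * (c - A' - B) + 2 * A' * c - A'\<^sup>2 - d\<^sup>2 - d / x * m0)) = 0)"
        by blast
    qed
    ultimately show ?thesis by (rule finite_subset[rotated])
  qed
qed


section \<open>Power flow on one line\<close>

definition net_load :: "network \<Rightarrow> nat \<Rightarrow> nat \<Rightarrow> real" where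
  "net_load N j t = pL N j t - pD N j t"

text \<open>The argument \<open>Pd\<close> is absent because the active power balance is kept apart:
  it is the equation of the circle on which \<open>(P, Q)\<close> lies.\<close>

definition line_state ::
  "network \<Rightarrow> nat \<Rightarrow> nat \<Rightarrow> real \<Rightarrow> real \<Rightarrow> real \<Rightarrow> real \<Rightarrow> line_vars" where
  "line_state N i t vs Qd P Q =
    (P, Q,
     vs - 2 * (res N i * P + rea N i * Q) + ((res N i)\<^sup>2 + (rea N i)\<^sup>2) * ((P\<^sup>2 + Q\<^sup>2) / vs),
     (P\<^sup>2 + Q\<^sup>2) / vs,
     Qd - Q + qL N (i+1) t + rea N i * ((P\<^sup>2 + Q\<^sup>2) / vs))"

lemma power_flow_iff:
  "power_flow N i t vs Pd Qd y \<longleftrightarrow>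
     y = line_state N i t vs Qd (actP y) (reaQ y) \<and>
     res N i * ((actP y)\<^sup>2 + (reaQ y)\<^sup>2) / vs = actP y - Pd - net_load N (i+1) t"
  by (cases y) (auto simp: line_state_def net_load_def)

lemma power_flow_circle:
  assumes "power_flow N i t vs Pd Qd y" "res N i > 0" "vs > 0"
  shows "(actP y)\<^sup>2 + (reaQ y)\<^sup>2 = vs / res N i * (actP y - (Pd + net_load N (i+1) t))"
  using assms unfolding power_flow_iff by (simp add: field_simps)

lemma line_state_sel [simp]:
  "actP (line_state N i t vs Qd P Q) = P"
  "reaQ (line_state N i t vs Qd P Q) = Q"
  "volt (line_state N i t vs Qd P Q) = vs - 2 * (res N i * P + rea N i * Q)
     + ((res N i)\<^sup>2 + (rea N i)\<^sup>2) * ((P\<^sup>2 + Q\<^sup>2) / vs)"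
  "curr (line_state N i t vs Qd P Q) = (P\<^sup>2 + Q\<^sup>2) / vs"
  "derq (line_state N i t vs Qd P Q)
     = Qd - Q + qL N (i+1) t + rea N i * ((P\<^sup>2 + Q\<^sup>2) / vs)"
  by (simp_all add: line_state_def)

section \<open>Active bounds on one line\<close>

lemma var_bounds_iff:
  "var_bounds N i t y \<longleftrightarrow> volt_ok (volt y) \<and>
     \<bar>derq y\<bar> \<le> sqrt ((SDR N (i+1))\<^sup>2 - (pD N (i+1) t)\<^sup>2) \<and> curr y \<le> (Irated N i)\<^sup>2"
  by (cases y) auto

definition der_active :: "network \<Rightarrow> nat \<Rightarrow> nat \<Rightarrow> line_vars \<Rightarrow> bool" where
  "der_active N i t y \<longleftrightarrow> \<bar>derq y\<bar> = sqrt ((SDR N (i+1))\<^sup>2 - (pD N (i+1) t)\<^sup>2)"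

definition curr_active :: "network \<Rightarrow> nat \<Rightarrow> line_vars \<Rightarrow> bool" where
  "curr_active N i y \<longleftrightarrow> curr y = (Irated N i)\<^sup>2"

definition volt_active :: "line_vars \<Rightarrow> bool" where
  "volt_active y \<longleftrightarrow> volt y = Vmin\<^sup>2 \<or> volt y = Vmax\<^sup>2"

text \<open>\<open>reaQ y = 0\<close> is included because it marks the critical points of \<open>P\<close> on the circle of
  power flow solutions.\<close>

definition line_pinned :: "network \<Rightarrow> nat \<Rightarrow> nat \<Rightarrow> line_vars \<Rightarrow> bool" where
  "line_pinned N i t y \<longleftrightarrow>
     reaQ y = 0 \<or> volt_active y \<or> der_active N i t y \<or> curr_active N i y"

text \<open>On the circle the squared current is affine in \<open>P\<close>, hence voltage and
  reactive output are affine in \<open>(P, Q)\<close>. Each way of being pinned cuts the circle with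
  a line.\<close>

lemma finite_line_pinned:
  assumes "res N i > 0" "vs > 0"
  shows "finite {y. power_flow N i t vs Pd Qd y \<and> line_pinned N i t y}"
proof -
  let ?r = "res N i" and ?x = "rea N i"
  define D where "D = ?r\<^sup>2 + ?x\<^sup>2"
  define A where "A = Pd + net_load N (i+1) t"
  define B where "B = sqrt ((SDR N (i+1))\<^sup>2 - (pD N (i+1) t)\<^sup>2)"
  define C where "C e h = {(P, Q). P\<^sup>2 + Q\<^sup>2 = vs / ?r * P + - (vs / ?r * A) \<and> poly e P + Q * poly h P = 0}"
    for e h :: "real poly"
  have fin: "finite (C e h)" if "e \<noteq> 0 \<or> h \<noteq> 0" for e h
    unfolding C_def using that by (rule finite_circle_zeros)
  have C_volt: "finite (C [:vs - D * A / ?r - V, D / ?r - 2 * ?r:] [:- 2 * ?x:])" for V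
  proof (rule fin)
    \<comment> \<open>If the reactance is zero, the slope \<open>D / ?r - 2 * ?r\<close> equals
      \<open>- ?r\<close>, which is nonzero.\<close>
    show "[:vs - D * A / ?r - V, D / ?r - 2 * ?r:] \<noteq> 0 \<or> [:- 2 * ?x:] \<noteq> 0"
      using assms by (auto simp: D_def power2_eq_square)
  qed
  define T where "T = C 0 1
    \<union> C [:vs - D * A / ?r - Vmin\<^sup>2, D / ?r - 2 * ?r:] [:- 2 * ?x:]
    \<union> C [:vs - D * A / ?r - Vmax\<^sup>2, D / ?r - 2 * ?r:] [:- 2 * ?x:]
    \<union> C [:Qd + qL N (i+1) t - ?x * A / ?r - B, ?x / ?r:] [:- 1:]
    \<union> C [:Qd + qL N (i+1) t - ?x * A / ?r + B, ?x / ?r:] [:- 1:]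
    \<union> C [:- A / ?r - (Irated N i)\<^sup>2, 1 / ?r:] 0"
  have "finite T" unfolding T_def using assms by (intro finite_UnI C_volt fin) auto
  moreover have "{y. power_flow N i t vs Pd Qd y \<and> line_pinned N i t y}
      \<subseteq> (\<lambda>(P, Q). line_state N i t vs Qd P Q) ` T"
  proof clarify
    fix y assume pf: "power_flow N i t vs Pd Qd y" and pin: "line_pinned N i t y"
    define P Q where "P = actP y" and "Q = reaQ y"
    have y: "y = line_state N i t vs Qd P Q" using pf by (simp add: power_flow_iff P_def Q_def)
    have circ: "P\<^sup>2 + Q\<^sup>2 = vs / ?r * (P - A)"
      using power_flow_circle[OF pf assms] by (simp add: P_def Q_def A_def)
    then have l: "(P\<^sup>2 + Q\<^sup>2) / vs = (P - A) / ?r" using assms by simp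
    have circ': "P\<^sup>2 + Q\<^sup>2 = vs / ?r * P + - (vs / ?r * A)" using circ by (simp add: right_diff_distrib)
    have "(P, Q) \<in> T"
      using pin circ' unfolding line_pinned_def volt_active_def der_active_def curr_active_def y
        line_state_sel l T_def C_def B_def[symmetric] D_def[symmetric]
      by (auto simp: abs_if diff_divide_distrib algebra_simps split: if_splits)
    then show "y \<in> (\<lambda>(P, Q). line_state N i t vs Qd P Q) ` T" unfolding y by force
  qed
  ultimately show ?thesis by (rule finite_surj)
qed

section \<open>Persistence of inactive constraints under small motions\<close>

lemma isCont_components:
  fixes Y :: "real \<Rightarrow> line_vars"
  assumes "Y = (\<lambda>s. line_state N i t vs (Qd s) (P s) (Q s))"
    and "isCont P s" "isCont Q s" "isCont Qd s"
  shows "isCont (\<lambda>s. volt (Y s)) s" "isCont (\<lambda>s. curr (Y s)) s" "isCont (\<lambda>s. derq (Y s)) s"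
proof -
  \<comment> \<open>Written as a product, the quotient is continuous without a condition on
    \<open>vs\<close>.\<close>
  have l: "(p\<^sup>2 + q\<^sup>2) / vs = (p\<^sup>2 + q\<^sup>2) * inverse vs" for p q :: real by (rule divide_inverse)
  show "isCont (\<lambda>s. volt (Y s)) s" "isCont (\<lambda>s. curr (Y s)) s" "isCont (\<lambda>s. derq (Y s)) s"
    unfolding assms(1) line_state_sel l using assms(2-) by (intro continuous_intros; simp)+
qed

lemma eventually_le_of_isCont:
  fixes f g :: "real \<Rightarrow> real"
  assumes "isCont f s" "isCont g s" "f s \<le> g s" "f s \<noteq> g s"
  shows "\<forall>\<^sub>F u in nhds s. f u \<le> g u"
proof -
  have "(\<lambda>u. g u - f u) \<midarrow>s\<rightarrow> g s - f s" using assms(1,2) by (auto intro: tendsto_diff simp: isCont_def)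
  then have "\<forall>\<^sub>F u in at s. 0 < g u - f u" using assms(3,4) by (intro order_tendstoD(1)) auto
  then have "\<forall>\<^sub>F u in nhds s. u \<noteq> s \<longrightarrow> 0 < g u - f u" by (simp add: eventually_at_filter)
  then show ?thesis by (rule eventually_mono) (use assms(3) in force)
qed

lemma eventually_volt_ok:
  fixes Y :: "real \<Rightarrow> line_vars"
  assumes "isCont (\<lambda>s. volt (Y s)) s0" "volt_ok (volt (Y s0))" "\<not> volt_active (Y s0)"
  shows "\<forall>\<^sub>F s in nhds s0. volt_ok (volt (Y s))"
  unfolding volt_ok_def
  by (intro eventually_conj eventually_le_of_isCont assms continuous_const)
    (use assms(2,3) in \<open>auto simp: volt_ok_def volt_active_def\<close>)

text \<open>The voltage bound enters as a hypothesis so that the lemma also covers motions that keep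
  the voltage constant, possibly at an active bound.\<close>

lemma eventually_var_bounds:
  fixes Y :: "real \<Rightarrow> line_vars"
  assumes "isCont (\<lambda>s. curr (Y s)) s0" "isCont (\<lambda>s. derq (Y s)) s0"
    and "var_bounds N i t (Y s0)" "\<not> der_active N i t (Y s0)" "\<not> curr_active N i (Y s0)"
    and "\<forall>\<^sub>F s in nhds s0. volt_ok (volt (Y s))"
  shows "\<forall>\<^sub>F s in nhds s0. var_bounds N i t (Y s)"
  unfolding var_bounds_iff
  by (intro eventually_conj eventually_le_of_isCont assms continuous_const continuous_rabs)
    (use assms(3-5) in \<open>auto simp: var_bounds_iff der_active_def curr_active_def\<close>)

section \<open>Rotations of the flow and stationarity\<close>

lemma DERIV_rotation:
  fixes h k p q :: real
  shows "((\<lambda>s. h + (p - h) * cos s - (q - k) * sin s) has_real_derivative - (q - k)) (at 0)"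
  by (auto intro!: derivative_eq_intros)

text \<open>Up to the constant \<open>h\<^sup>2 + k\<^sup>2\<close> this is the squared distance to
  the centre \<open>(h, k)\<close> of the rotation.\<close>

lemma rotation_norm:
  fixes h k p q :: real
  assumes "P = h + (p - h) * cos s - (q - k) * sin s" "Q = k + (p - h) * sin s + (q - k) * cos s"
  shows "P\<^sup>2 + Q\<^sup>2 - 2 * (h * P + k * Q) = p\<^sup>2 + q\<^sup>2 - 2 * (h * p + k * q)"
  using assms sin_cos_squared_add[of s] by algebra


lemma DERIV_eventually_min:
  fixes f :: "real \<Rightarrow> real"
  assumes "(f has_real_derivative l) (at u)" "\<forall>\<^sub>F s in nhds u. f u \<le> f s"
  shows "l = 0"
proof -
  obtain d where "d > 0" "\<forall>s. dist s u < d \<longrightarrow> f u \<le> f s"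
    using assms(2) unfolding eventually_nhds_metric by blast
  then show ?thesis using assms(1) by (intro DERIV_local_min) (auto simp: dist_real_def abs_minus_commute)
qed

lemma is_arg_min_le: "is_arg_min f F z \<Longrightarrow> F y \<Longrightarrow> f z \<le> (f y :: real)"
  unfolding is_arg_min_def by (meson not_le)

section \<open>Minimizers of the two-step problem\<close>

declare S_feasible.simps [simp del]

locale two_step_problem =
  fixes N :: network and X :: iterates and i t :: nat and v w :: real
  assumes res_i: "res N i > 0" and res_j: "res N (i+1) > 0" and rea_i: "rea N i > 0"
    and v: "v > 0" and w: "w > 0"
    and vm_i: "vm X i (t-1) = v" "vm X i t = v" and vm_j: "vm X (i+1) (t-1) = w"
    and Dl_pos: "Dl X (i+1) (t+1) > 0"
begin

abbreviation "r \<equiv> res N i"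
abbreviation "x \<equiv> rea N i"
abbreviation "\<rho> \<equiv> res N (i+1)"
abbreviation "D \<equiv> r\<^sup>2 + x\<^sup>2"
abbreviation "\<Delta> \<equiv> Dl X (i+1) (t+1)"
abbreviation "Qd \<equiv> fQ X (i+1) (t-1)"
abbreviation "A \<equiv> fP X (i+1) (t-1) + net_load N (i+1) t"
abbreviation "A' \<equiv> net_load N (i+1) (t+1)"
abbreviation "B \<equiv> net_load N (i+1+1) t"

abbreviation "minimizer \<equiv> is_arg_min (S_objective N i) (S_feasible N X i t)"

lemma D_pos: "D > 0"
  using res_i by (simp add: add_pos_nonneg)

definition window_active :: "line_vars \<Rightarrow> line_vars \<Rightarrow> bool" where
  "window_active a c \<longleftrightarrow> (\<exists>\<kappa>\<in>{1 / \<Delta>, \<Delta>}. volt c = \<kappa> * volt a)"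

lemma S_feasible_iff:
  "S_feasible N X i t (a, b, c) \<longleftrightarrow>
     a = line_state N i t v Qd (actP a) (reaQ a) \<and>
     r * ((actP a)\<^sup>2 + (reaQ a)\<^sup>2) / v = actP a - A \<and>
     b = line_state N (i+1) t w 0 (actP b) (reaQ b) \<and>
     \<rho> * ((actP b)\<^sup>2 + (reaQ b)\<^sup>2) / w = actP b - B \<and>
     c = line_state N i (t+1) v (reaQ b) (actP c) (reaQ c) \<and>
     r * ((actP c)\<^sup>2 + (reaQ c)\<^sup>2) / v = actP c - actP b - A' \<and>
     delta_window \<Delta> (volt a) (volt c) \<and> volt_ok v \<and>
     var_bounds N i t a \<and> var_bounds N (i+1) t b \<and> var_bounds N i (t+1) c"
  unfolding S_feasible.simps vm_i vm_j power_flow_iff by (auto simp: algebra_simps)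

text \<open>The three active power balances are added; \<open>actP b\<close> cancels between line
  \<open>(j, k)\<close> at step \<open>t\<close> and line \<open>(i, j)\<close> at step
  \<open>t+1\<close>.\<close>

lemma S_objective_eq:
  assumes "S_feasible N X i t (a, b, c)"
  shows "S_objective N i (a, b, c) = actP a + actP c - (A + A' + B)"
proof -
  have "curr a = ((actP a)\<^sup>2 + (reaQ a)\<^sup>2) / v" "curr b = ((actP b)\<^sup>2 + (reaQ b)\<^sup>2) / w"
    "curr c = ((actP c)\<^sup>2 + (reaQ c)\<^sup>2) / v"
    using assms unfolding S_feasible_iff by (metis line_state_sel(4))+
  then show ?thesis using assms unfolding S_feasible_iff S_objective.simps by simp
qed

section \<open>First-order conditions at a minimizer\<close>

lemma minimizer_le:
  assumes "minimizer (a, b, c)" "S_feasible N X i t (a', b', c')"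
  shows "actP a + actP c \<le> actP a' + actP c'"
  using is_arg_min_le[OF assms] S_objective_eq[OF assms(2)] S_objective_eq[of a b c] assms(1)
  by (simp add: is_arg_min_def)

text \<open>Apart from its own equations and bounds, \<open>a\<close> enters only the window. If
  nothing is active, it can be rotated on its circle with \<open>b\<close> and \<open>c\<close>
  fixed; \<open>P\<close> has derivative \<open>- reaQ a\<close> there, so minimality forces
  \<open>reaQ a = 0\<close>.\<close>

lemma minimizer_upstream:
  assumes min: "minimizer (a, b, c)"
  shows "line_pinned N i t a \<or> window_active a c"
proof (rule ccontr)
  assume not: "\<not> ?thesis"
  have feas: "S_feasible N X i t (a, b, c)" using min by (simp add: is_arg_min_def)
  note F = feas[unfolded S_feasible_iff]
  \<comment> \<open>The point \<open>(h, 0)\<close> is the centre of the circle of power flow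
    solutions.\<close>
  define h where "h = v / (2 * r)"
  define p q where "p = actP a" and "q = reaQ a"
  define P where "P s = h + (p - h) * cos s - (q - 0) * sin s" for s
  define Q where "Q s = 0 + (p - h) * sin s + (q - 0) * cos s" for s
  define Y where "Y = (\<lambda>s. line_state N i t v Qd (P s) (Q s))"
  have Y0: "Y 0 = a" using F by (simp add: Y_def P_def Q_def p_def q_def)
  have cont: "isCont P s" "isCont Q s" for s
    unfolding P_def Q_def by (intro continuous_intros)+
  note cY = isCont_components[OF Y_def cont continuous_const]
  have circ: "r * ((P s)\<^sup>2 + (Q s)\<^sup>2) / v = P s - A" for s
  proof -
    have "r * (p\<^sup>2 + q\<^sup>2) / v = p - A" using F by (simp add: p_def q_def)
    moreover have "(P s)\<^sup>2 + (Q s)\<^sup>2 - 2 * (h * P s + 0 * Q s) = p\<^sup>2 + q\<^sup>2 - 2 * (h * p + 0 * q)"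
      by (rule rotation_norm) (simp_all add: P_def Q_def)
    ultimately show ?thesis using res_i v by (simp add: h_def field_simps)
  qed
  have bnd: "\<forall>\<^sub>F s in nhds 0. var_bounds N i t (Y s)"
    using not F cY by (intro eventually_var_bounds eventually_volt_ok)
      (auto simp: Y0 line_pinned_def var_bounds_iff)
  have win: "\<forall>\<^sub>F s in nhds 0. delta_window \<Delta> (volt (Y s)) (volt c)"
    unfolding delta_window_def
    by (intro eventually_conj eventually_le_of_isCont continuous_intros cY)
      (use F not Dl_pos in \<open>auto simp: Y0 delta_window_def window_active_def field_simps\<close>)
  have "\<forall>\<^sub>F s in nhds 0. S_feasible N X i t (Y s, b, c)"
    using bnd win by eventually_elim (use F circ in \<open>simp add: S_feasible_iff Y_def\<close>)
  then have "\<forall>\<^sub>F s in nhds 0. P 0 \<le> P s"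
  proof eventually_elim
    case (elim s)
    from minimizer_le[OF min this] show ?case by (simp add: Y_def P_def p_def)
  qed
  moreover have "(P has_real_derivative - (q - 0)) (at 0)"
    unfolding P_def by (rule DERIV_rotation)
  ultimately have "- (q - 0) = 0" by (rule DERIV_eventually_min[rotated])
  then show False using not by (simp add: line_pinned_def q_def)
qed

text \<open>Rotating \<open>(P, Q)\<close> on line \<open>(i, i+1)\<close> at step \<open>t+1\<close> about the point below keeps the voltage at
  the receiving node constant, so neither the voltage bounds nor the window can block the motion.\<close>

lemma minimizer_downstream:
  assumes min: "minimizer (a, b, c)"
  shows "line_pinned N (i+1) t b \<or> der_active N i (t+1) c \<or> curr_active N i c
    \<or> reaQ c = x * v / D"
proof (rule ccontr)
  assume not: "\<not> ?thesis"
  have feas: "S_feasible N X i t (a, b, c)" using min by (simp add: is_arg_min_def)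
  note F = feas[unfolded S_feasible_iff]
  define h where "h = r * v / D"
  define k where "k = x * v / D"
  define p q where "p = actP c" and "q = reaQ c"
  define P where "P s = h + (p - h) * cos s - (q - k) * sin s" for s
  define Q where "Q s = k + (p - h) * sin s + (q - k) * cos s" for s
  \<comment> \<open>Line \<open>(j, k)\<close> has to follow the motion: \<open>Pb\<close> comes
    from the active balance of line \<open>(i, j)\<close> at step \<open>t+1\<close>, and
    \<open>Qb\<close> solves the circle equation of line \<open>(j, k)\<close> on the branch through
    \<open>reaQ b\<close>. The branch is usable nearby because \<open>reaQ b\<close> is
    nonzero.\<close>
  define Pb where "Pb s = P s - A' - r * ((P s)\<^sup>2 + (Q s)\<^sup>2) * inverse v" for s
  define R where "R s = w / \<rho> * (Pb s - B) - (Pb s)\<^sup>2" for s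
  define Qb where "Qb s = sgn (reaQ b) * sqrt (R s)" for s
  define Y where "Y = (\<lambda>s. line_state N i (t+1) v (Qb s) (P s) (Q s))"
  define Z where "Z = (\<lambda>s. line_state N (i+1) t w 0 (Pb s) (Qb s))"
  have PQ0: "P 0 = p" "Q 0 = q" by (simp_all add: P_def Q_def)
  have Pb0: "Pb 0 = actP b" using F by (simp add: Pb_def PQ0 p_def q_def divide_inverse)
  have R0: "R 0 = (reaQ b)\<^sup>2" using F res_j w by (simp add: R_def Pb0 field_simps)
  have Qb0: "Qb 0 = reaQ b" by (simp add: Qb_def R0 sgn_mult_abs)
  have Y0: "Y 0 = c" using F by (simp add: Y_def PQ0 p_def q_def Qb0)
  have Z0: "Z 0 = b" using F by (simp add: Z_def Pb0 Qb0)
  have cont: "isCont P s" "isCont Q s" for s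
    unfolding P_def Q_def by (intro continuous_intros)+
  have cPb: "isCont Pb s" for s unfolding Pb_def by (intro continuous_intros cont)
  have cR: "isCont R s" for s unfolding R_def by (intro continuous_intros cPb)
  have cQb: "isCont Qb s" for s unfolding Qb_def by (intro continuous_intros cR)
  note cY = isCont_components[OF Y_def cont cQb]
  note cZ = isCont_components[OF Z_def cPb cQb continuous_const]
  have volt: "volt (Y s) = volt c" for s
  proof -
    have hk: "D * h = r * v" "D * k = x * v" using D_pos by (simp_all add: h_def k_def)
    have eq: "D / v * (P\<^sup>2 + Q\<^sup>2 - 2 * (h * P + k * Q))
        = D * ((P\<^sup>2 + Q\<^sup>2) / v) - 2 * ((D * h) * P + (D * k) * Q) / v" for P Q :: real
      using v by (simp add: field_simps)
    have "volt (line_state N i (t+1) v qd P Q)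
        = v + D / v * (P\<^sup>2 + Q\<^sup>2 - 2 * (h * P + k * Q))" for qd P Q
      unfolding line_state_sel eq hk using v by (simp add: field_simps)
    moreover have "(P s)\<^sup>2 + (Q s)\<^sup>2 - 2 * (h * P s + k * Q s) = p\<^sup>2 + q\<^sup>2 - 2 * (h * p + k * q)"
      by (rule rotation_norm) (simp_all add: P_def Q_def)
    ultimately show ?thesis unfolding Y0[symmetric] by (simp only: Y_def PQ0)
  qed
  have nz: "reaQ b \<noteq> 0" using not by (simp add: line_pinned_def)
  have "\<forall>\<^sub>F s in nhds 0. 0 \<le> R s"
    using nz by (intro eventually_le_of_isCont continuous_const cR) (auto simp: R0)
  then have pfb: "\<forall>\<^sub>F s in nhds 0. \<rho> * ((Pb s)\<^sup>2 + (Qb s)\<^sup>2) / w = Pb s - B"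
  proof eventually_elim
    case (elim s)
    then have "(Qb s)\<^sup>2 = R s" using nz by (simp add: Qb_def power_mult_distrib sgn_if)
    then show ?case using w res_j by (simp add: R_def field_simps)
  qed
  have bndb: "\<forall>\<^sub>F s in nhds 0. var_bounds N (i+1) t (Z s)"
    using not F cZ by (intro eventually_var_bounds eventually_volt_ok)
      (auto simp: Z0 line_pinned_def var_bounds_iff)
  have bndc: "\<forall>\<^sub>F s in nhds 0. var_bounds N i (t+1) (Y s)"
    using not F cY by (intro eventually_var_bounds) (auto simp: Y0 volt var_bounds_iff)
  have "\<forall>\<^sub>F s in nhds 0. S_feasible N X i t (a, Z s, Y s)"
    using pfb bndb bndc
  proof eventually_elim
    case (elim s)
    have "delta_window \<Delta> (volt a) (volt (Y s))" using F by (simp add: volt)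
    moreover have "r * ((P s)\<^sup>2 + (Q s)\<^sup>2) / v = P s - Pb s - A'" by (simp add: Pb_def divide_inverse)
    ultimately show ?case using F elim by (simp add: S_feasible_iff Y_def Z_def)
  qed
  then have "\<forall>\<^sub>F s in nhds 0. P 0 \<le> P s"
  proof eventually_elim
    case (elim s)
    from minimizer_le[OF min this] show ?case by (simp add: Y_def PQ0 p_def)
  qed
  moreover have "(P has_real_derivative - (q - k)) (at 0)"
    unfolding P_def by (rule DERIV_rotation)
  ultimately have "- (q - k) = 0" by (rule DERIV_eventually_min[rotated])
  then show False using not by (simp add: q_def k_def)
qed


text \<open>The minimizers whose objective value is \<open>c\<close> up to the constant of \<open>S_objective_eq\<close>.\<close>

definition level_minimizers :: "real \<Rightarrow> sub_vars set" where
  "level_minimizers c = {(a, b, y). minimizer (a, b, y) \<and> actP a + actP y = c}"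

section \<open>Finiteness of the minimizers on one objective level\<close>

lemma level_minimizersD:
  assumes "(a, b, y) \<in> level_minimizers c"
  shows "a = line_state N i t v Qd (actP a) (reaQ a)"
    and "b = line_state N (i+1) t w 0 (actP b) (reaQ b)"
    and "y = line_state N i (t+1) v (reaQ b) (c - actP a) (reaQ y)"
    and "actP y = c - actP a"
    and "(actP a)\<^sup>2 + (reaQ a)\<^sup>2 = v / r * (actP a - A)"
    and "r * ((c - actP a)\<^sup>2 + (reaQ y)\<^sup>2) / v = c - actP a - actP b - A'"
    and "(reaQ b)\<^sup>2 = w / \<rho> * (actP b - B) - (actP b)\<^sup>2"
    and "power_flow N i t v (fP X (i+1) (t-1)) Qd a"
    and "power_flow N (i+1) t w 0 0 b"
    and "volt a = v - D / r * A + (D / r - 2 * r) * actP a - 2 * x * reaQ a"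
    and "volt y = v - 2 * r * (c - actP a) - 2 * x * reaQ y + D * curr y"
    and "v * curr y = (c - actP a)\<^sup>2 + (reaQ y)\<^sup>2"
    and "derq y = reaQ b - reaQ y + qL N (i+1) (t+1) + x * curr y"
proof -
  have feas: "S_feasible N X i t (a, b, y)" and sum: "actP a + actP y = c"
    using assms by (auto simp: level_minimizers_def is_arg_min_def)
  note F = feas[unfolded S_feasible_iff]
  show P': "actP y = c - actP a" using sum by simp
  show a: "a = line_state N i t v Qd (actP a) (reaQ a)" using F by blast
  show "b = line_state N (i+1) t w 0 (actP b) (reaQ b)" using F by blast
  have "y = line_state N i (t+1) v (reaQ b) (actP y) (reaQ y)" using F by blast
  then show y: "y = line_state N i (t+1) v (reaQ b) (c - actP a) (reaQ y)" unfolding P' .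
  show circ: "(actP a)\<^sup>2 + (reaQ a)\<^sup>2 = v / r * (actP a - A)"
    using F res_i v by (simp add: field_simps)
  show "r * ((c - actP a)\<^sup>2 + (reaQ y)\<^sup>2) / v = c - actP a - actP b - A'"
    using F unfolding P' by blast
  have "\<rho> * ((actP b)\<^sup>2 + (reaQ b)\<^sup>2) / w = actP b - B" using F by blast
  then show "(reaQ b)\<^sup>2 = w / \<rho> * (actP b - B) - (actP b)\<^sup>2"
    using res_j w by (simp add: field_simps)
  show "power_flow N i t v (fP X (i+1) (t-1)) Qd a" "power_flow N (i+1) t w 0 0 b"
    using feas unfolding S_feasible.simps vm_i vm_j by blast+
  show "volt a = v - D / r * A + (D / r - 2 * r) * actP a - 2 * x * reaQ a"
    using v res_i by (subst a, unfold line_state_sel circ) (simp add: field_simps)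
  show curr: "v * curr y = (c - actP a)\<^sup>2 + (reaQ y)\<^sup>2"
    using v by (subst y) simp
  then have l: "curr y = ((c - actP a)\<^sup>2 + (reaQ y)\<^sup>2) / v" using v by (simp add: field_simps)
  show "volt y = v - 2 * r * (c - actP a) - 2 * x * reaQ y + D * curr y"
    by (subst y, unfold line_state_sel l) (simp add: algebra_simps)
  show "derq y = reaQ b - reaQ y + qL N (i+1) (t+1) + x * curr y"
    by (subst y, unfold line_state_sel l) simp
qed

text \<open>For given \<open>c\<close>, the three listed flows determine all other variables up to
  the sign of \<open>reaQ b\<close>, whose square is known.\<close>

lemma finite_level_fibre:
  assumes "finite T" "S \<subseteq> level_minimizers c"
    and "\<And>a b y. (a, b, y) \<in> S \<Longrightarrow> (actP a, reaQ a, reaQ y) \<in> T"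
  shows "finite S"
proof -
  define Pb where "Pb P Q' = c - P - A' - r * ((c - P)\<^sup>2 + Q'\<^sup>2) / v" for P Q'
  define G where "G = (\<lambda>(P, Q, Q'). (\<lambda>Qb. (line_state N i t v Qd P Q,
      line_state N (i+1) t w 0 (Pb P Q') Qb, line_state N i (t+1) v Qb (c - P) Q')) `
      {Qb. Qb\<^sup>2 = w / \<rho> * (Pb P Q' - B) - (Pb P Q')\<^sup>2})"
  have "finite (\<Union>\<tau>\<in>T. G \<tau>)"
    using assms(1) by (intro finite_UN_I) (auto simp: G_def finite_square_eq)
  moreover have "S \<subseteq> (\<Union>\<tau>\<in>T. G \<tau>)"
  proof clarify
    fix a b y assume S: "(a, b, y) \<in> S"
    then have "(a, b, y) \<in> level_minimizers c" using assms(2) by blast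
    note L = level_minimizersD[OF this]
    have Pb: "actP b = Pb (actP a) (reaQ y)" using L(6) by (simp add: Pb_def)
    have "(a, b, y) \<in> G (actP a, reaQ a, reaQ y)"
      unfolding G_def prod.case
    proof (rule image_eqI)
      show "(a, b, y) = (line_state N i t v Qd (actP a) (reaQ a),
        line_state N (i+1) t w 0 (Pb (actP a) (reaQ y)) (reaQ b),
        line_state N i (t+1) v (reaQ b) (c - actP a) (reaQ y))"
        using L(1-3) Pb by simp
    qed (use L(7) Pb in simp)
    then show "(a, b, y) \<in> (\<Union>\<tau>\<in>T. G \<tau>)" using assms(3)[OF S] by blast
  qed
  ultimately show ?thesis by (rule finite_subset[rotated])
qed

lemma der_activeD:
  assumes "der_active N i (t+1) y"
  shows "\<exists>q\<in>{sqrt ((SDR N (i+1))\<^sup>2 - (pD N (i+1) (t+1))\<^sup>2),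
                - sqrt ((SDR N (i+1))\<^sup>2 - (pD N (i+1) (t+1))\<^sup>2)}. derq y = q"
  using assms by (auto simp: der_active_def abs_if split: if_splits)

text \<open>Substituting the power flow of line \<open>(i, i+1)\<close> at step \<open>t+1\<close> into that of line \<open>(i+1, i+2)\<close>
  eliminates \<open>actP b\<close> and \<open>reaQ b\<close>.\<close>

lemma level_minimizers_derq:
  assumes "(a, b, y) \<in> level_minimizers c"
  shows "(c - actP a - r * curr y - A')\<^sup>2 + (reaQ y - x * curr y + (derq y - qL N (i+1) (t+1)))\<^sup>2
    = w / \<rho> * (c - actP a - r * curr y - A' - B)"
proof -
  note L = level_minimizersD[OF assms]
  have "c - actP a - r * curr y - A' = actP b"
    using L(6) v unfolding L(12)[symmetric] by simp
  moreover have "reaQ y - x * curr y + (derq y - qL N (i+1) (t+1)) = reaQ b" using L(13) by simp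
  ultimately show ?thesis using L(7) by simp
qed

text \<open>A pinned \<open>a\<close> has finitely many values, hence so has
  \<open>actP y = c - actP a\<close>. For each of them, every alternative of
  \<open>minimizer_downstream\<close> leaves finitely many \<open>reaQ y\<close>.\<close>

lemma finite_level_pinned:
  "finite {(a, b, y) \<in> level_minimizers c. line_pinned N i t a}"
proof -
  define Fa where "Fa = {a. power_flow N i t v (fP X (i+1) (t-1)) Qd a \<and> line_pinned N i t a}"
  define Fb where "Fb = {b. power_flow N (i+1) t w 0 0 b \<and> line_pinned N (i+1) t b}"
  have fin: "finite Fa" "finite Fb"
    unfolding Fa_def Fb_def by (rule finite_line_pinned; use res_i res_j v w in simp)+
  \<comment> \<open>The equation of \<open>level_minimizers_derq\<close> as a quartic in
    \<open>reaQ y\<close>, with \<open>p\<close> for the active flow at step \<open>t+1\<close>. Its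
    leading coefficient is \<open>D / v\<^sup>2\<close>.\<close>
  define pol where "pol p q = [:p - r / v * p\<^sup>2 - A', 0, - r / v:]\<^sup>2
      + [:q - x / v * p\<^sup>2, 1, - x / v:]\<^sup>2
      - smult (w / \<rho>) [:p - r / v * p\<^sup>2 - A' - B, 0, - r / v:]" for p q
  define bd where "bd = sqrt ((SDR N (i+1))\<^sup>2 - (pD N (i+1) (t+1))\<^sup>2)"
  define R where "R p = (\<Union>b\<in>Fb. {Q'. Q'\<^sup>2 = v / r * (p - actP b - A') - p\<^sup>2})
      \<union> (\<Union>q\<in>{bd, - bd}. {Q'. poly (pol p (q - qL N (i+1) (t+1))) Q' = 0})
      \<union> {Q'. Q'\<^sup>2 = v * (Irated N i)\<^sup>2 - p\<^sup>2} \<union> {x * v / D}" for p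
  have "finite {Q'. poly (pol p q) Q' = 0}" for p q
  proof (rule poly_roots_finite)
    have "coeff (pol p q) 4 = D / v\<^sup>2"
      by (simp add: pol_def numeral_eq_Suc power2_eq_square add_divide_distrib)
    then show "pol p q \<noteq> 0" using D_pos v by auto
  qed
  then have finR: "finite (R p)" for p unfolding R_def using fin by (simp add: finite_square_eq)
  define T where "T = (\<Union>a\<in>Fa. (\<lambda>Q'. (actP a, reaQ a, Q')) ` R (c - actP a))"
  have "finite T" unfolding T_def using fin finR by simp
  then show ?thesis
  proof (rule finite_level_fibre)
    fix a b y assume "(a, b, y) \<in> {(a, b, y) \<in> level_minimizers c. line_pinned N i t a}"
    then have M: "(a, b, y) \<in> level_minimizers c" and pin: "line_pinned N i t a" by auto
    note L = level_minimizersD[OF M]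
    have Fa: "a \<in> Fa" using L(8) pin by (simp add: Fa_def)
    define p where "p = c - actP a"
    have "minimizer (a, b, y)" using M by (simp add: level_minimizers_def)
    from minimizer_downstream[OF this] have "reaQ y \<in> R p"
    proof (elim disjE)
      assume "line_pinned N (i+1) t b"
      then have "b \<in> Fb" using L(9) by (simp add: Fb_def)
      moreover have "(reaQ y)\<^sup>2 = v / r * (p - actP b - A') - p\<^sup>2"
        using L(6) res_i v by (simp add: p_def field_simps)
      ultimately show ?thesis by (auto simp: R_def)
    next
      assume "der_active N i (t+1) y"
      then obtain q where q: "q \<in> {bd, - bd}" and dq: "derq y = q"
        using der_activeD unfolding bd_def by blast
      have "curr y = (p\<^sup>2 + (reaQ y)\<^sup>2) / v" using L(12) v by (simp add: p_def field_simps)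
      then have "poly (pol p (q - qL N (i+1) (t+1))) (reaQ y)
        = (p - r * curr y - A')\<^sup>2 + (reaQ y - x * curr y + (q - qL N (i+1) (t+1)))\<^sup>2
          - w / \<rho> * (p - r * curr y - A' - B)"
        by (simp add: pol_def power2_eq_square algebra_simps add_divide_distrib)
      also have "\<dots> = 0" using level_minimizers_derq[OF M] unfolding p_def dq by simp
      finally show ?thesis using q by (auto simp: R_def)
    next
      assume "curr_active N i y"
      then have "(reaQ y)\<^sup>2 = v * (Irated N i)\<^sup>2 - p\<^sup>2" using L(12) by (simp add: p_def curr_active_def)
      then show ?thesis by (simp add: R_def)
    next
      assume "reaQ y = x * v / D"
      then show ?thesis by (simp add: R_def)
    qed
    then show "(actP a, reaQ a, reaQ y) \<in> T" using Fa by (auto simp: T_def p_def)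
  qed auto
qed

text \<open>Given \<open>(P, Q)\<close>, the ratio equation is a nonzero quadratic in
  \<open>reaQ y\<close>. So it suffices to confine \<open>(P, Q)\<close> to a finite set, separately
  for each alternative of \<open>minimizer_downstream\<close>.\<close>

lemma finite_level_volt_ratio:
  assumes c: "2 * c < v / r" and \<kappa>: "\<kappa> > 0"
  shows "finite {(a, b, y) \<in> level_minimizers c. volt y = \<kappa> * volt a}"
proof -
  define \<alpha> where "\<alpha> = D / r - 2 * r"
  define a0 where "a0 = - (v / r * A)"
  define W where "W = v - D / r * A"
  define Fb where "Fb = {b. power_flow N (i+1) t w 0 0 b \<and> line_pinned N (i+1) t b}"
  have finb: "finite Fb"
    unfolding Fb_def by (rule finite_line_pinned; use res_j w in simp)
  define bd where "bd = sqrt ((SDR N (i+1))\<^sup>2 - (pD N (i+1) (t+1))\<^sup>2)"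
  \<comment> \<open>\<open>C1\<close> treats a pinned \<open>b\<close>, \<open>C2\<close> the
    thermal bound, \<open>C3\<close> the DER bound and \<open>C4\<close> the extreme point
    \<open>q0\<close>. In \<open>C1\<close> the squared current at step \<open>t+1\<close> is affine
    in \<open>P\<close>, in \<open>C2\<close> it is constant; either way the ratio equation makes
    \<open>Q'\<close> affine in \<open>(P, Q)\<close>.\<close>
  define C1 where "C1 Pb = {(P, Q). P\<^sup>2 + Q\<^sup>2 = v / r * P + a0 \<and>
      (c - P)\<^sup>2 + (\<kappa> * Q + - (\<alpha> * (1 + \<kappa>) / (2 * x)) * P
        + (v + \<alpha> * c - D / r * (Pb + A') - \<kappa> * W) / (2 * x))\<^sup>2
      = - (v / r) * P + v / r * (c - Pb - A')}" for Pb
  define C2 where "C2 = {(P, Q). P\<^sup>2 + Q\<^sup>2 = v / r * P + a0 \<and>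
      (c - P)\<^sup>2 + (\<kappa> * Q + (2 * r - \<kappa> * \<alpha>) / (2 * x) * P
        + (v - 2 * r * c + D * (Irated N i)\<^sup>2 - \<kappa> * W) / (2 * x))\<^sup>2
      = 0 * P + v * (Irated N i)\<^sup>2}"
  define C3 where "C3 q = {(P, Q). P\<^sup>2 + Q\<^sup>2 = v / r * (P - A) \<and> (\<exists>Q' \<sigma>.
      v * \<sigma> = (c - P)\<^sup>2 + Q'\<^sup>2 \<and>
      v - 2 * r * (c - P) - 2 * x * Q' + D * \<sigma>
        = \<kappa> * (v - 2 * r * P - 2 * x * Q + D / v * (P\<^sup>2 + Q\<^sup>2)) \<and>
      (c - P - r * \<sigma> - A')\<^sup>2 + (Q' - x * \<sigma> + (q - qL N (i+1) (t+1)))\<^sup>2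
        = w / \<rho> * (c - P - r * \<sigma> - A' - B))}" for q
  define q0 where "q0 = x * v / D"
  define C4 where "C4 = {(P, Q). P\<^sup>2 + Q\<^sup>2 = v / r * P + a0 \<and>
      poly [:v - 2 * r * c - 2 * x * q0 + D / v * (c\<^sup>2 + q0\<^sup>2) - \<kappa> * W,
             2 * r - 2 * c * (D / v) - \<kappa> * \<alpha>, D / v:] P + Q * poly [:2 * x * \<kappa>:] P = 0}"
  have ne: "v / r > 0" using v res_i by simp
  define C where "C = (\<Union>b\<in>Fb. C1 (actP b)) \<union> C2 \<union> (\<Union>q\<in>{bd, - bd}. C3 q) \<union> C4"
  \<comment> \<open>The exceptional value of \<open>c\<close> is \<open>v / r\<close> for
    \<open>C1\<close> and \<open>v / (2 * r)\<close> for \<open>C2\<close> and \<open>C3\<close>;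
    the bound on \<open>c\<close> lies below both.\<close>
  have "finite (C1 Pb)" for Pb
    unfolding C1_def by (rule finite_circle_inter_circle) (use \<kappa> c ne in auto)
  moreover have "finite C2"
    unfolding C2_def by (rule finite_circle_inter_circle) (use \<kappa> c ne in auto)
  moreover have "finite (C3 q)" for q
    unfolding C3_def using c \<kappa> res_i rea_i v by (intro finite_volt_ratio_derq_active) auto
  moreover have "finite C4"
    unfolding C4_def by (rule finite_circle_zeros) (use \<kappa> rea_i in simp)
  ultimately have finC: "finite C" unfolding C_def using finb by simp
  define R where "R = (\<lambda>(P, Q). {Q'. poly
      [:v - 2 * r * (c - P) + D / v * (c - P)\<^sup>2 - \<kappa> * (W + \<alpha> * P - 2 * x * Q), - 2 * x, D / v:] Q' = 0})"
  define T where "T = (\<Union>(P, Q)\<in>C. (\<lambda>Q'. (P, Q, Q')) ` R (P, Q))"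
  have "finite (R (P, Q))" for P Q
    unfolding R_def prod.case by (rule poly_roots_finite) (use rea_i in simp)
  then have "finite T" unfolding T_def using finC by auto
  then show ?thesis
  proof (rule finite_level_fibre)
    fix a b y assume "(a, b, y) \<in> {(a, b, y) \<in> level_minimizers c. volt y = \<kappa> * volt a}"
    then have M: "(a, b, y) \<in> level_minimizers c" and vy: "volt y = \<kappa> * volt a" by auto
    note L = level_minimizersD[OF M]
    define P Q Q' where "P = actP a" and "Q = reaQ a" and "Q' = reaQ y"
    note L' = L[folded P_def Q_def Q'_def]
    have circ: "P\<^sup>2 + Q\<^sup>2 = v / r * P + a0" using L'(5) by (simp add: a0_def right_diff_distrib)
    have va: "volt a = W + \<alpha> * P - 2 * x * Q" using L'(10) by (simp add: W_def \<alpha>_def)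
    have win: "v - 2 * r * (c - P) - 2 * x * Q' + D * curr y = \<kappa> * (W + \<alpha> * P - 2 * x * Q)"
      using vy L'(11) va by simp
    have curr: "curr y = ((c - P)\<^sup>2 + Q'\<^sup>2) / v" using L'(12) v by (simp add: field_simps)
    have "minimizer (a, b, y)" using M by (simp add: level_minimizers_def)
    from minimizer_downstream[OF this] have "(P, Q) \<in> C"
    proof (elim disjE)
      assume "line_pinned N (i+1) t b"
      then have b: "b \<in> Fb" using L(9) by (simp add: Fb_def)
      define Pb where "Pb = actP b"
      have l: "curr y = (c - P - Pb - A') / r"
        using L'(6) res_i unfolding L'(12)[symmetric] Pb_def using v by (simp add: field_simps)
      define E where "E = D / r"
      have Dl: "D * curr y = E * (c - P - Pb - A')" unfolding l E_def by simp
      have "2 * x * Q' = 2 * x * \<kappa> * Q - \<alpha> * (1 + \<kappa>) * P + (v + \<alpha> * c - D / r * (Pb + A') - \<kappa> * W)"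
        using win unfolding Dl \<alpha>_def E_def[symmetric] by (simp add: algebra_simps)
      then have "Q' = (2 * x * \<kappa> * Q - \<alpha> * (1 + \<kappa>) * P + (v + \<alpha> * c - D / r * (Pb + A') - \<kappa> * W)) / (2 * x)"
        using rea_i by (simp add: eq_divide_eq mult.commute)
      then have Q': "\<kappa> * Q + - (\<alpha> * (1 + \<kappa>) / (2 * x)) * P
        + (v + \<alpha> * c - D / r * (Pb + A') - \<kappa> * W) / (2 * x) = Q'"
        using rea_i by (simp add: add_divide_distrib diff_divide_distrib)
      have "(c - P)\<^sup>2 + Q'\<^sup>2 = v * ((c - P - Pb - A') / r)" using L'(12) l by simp
      also have "\<dots> = - (v / r) * P + v / r * (c - Pb - A')" using res_i by (simp add: field_simps)
      finally have "(P, Q) \<in> C1 Pb" unfolding C1_def using circ Q' by simp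
      then show ?thesis using b by (auto simp: C_def Pb_def)
    next
      assume "der_active N i (t+1) y"
      then obtain q where q: "q \<in> {bd, - bd}" and dq: "derq y = q"
        using der_activeD unfolding bd_def by blast
      have "v - 2 * r * P - 2 * x * Q + D / v * (P\<^sup>2 + Q\<^sup>2) = W + \<alpha> * P - 2 * x * Q"
        unfolding L'(5) W_def \<alpha>_def using v res_i by (simp add: field_simps)
      then have "v - 2 * r * (c - P) - 2 * x * Q' + D * curr y
          = \<kappa> * (v - 2 * r * P - 2 * x * Q + D / v * (P\<^sup>2 + Q\<^sup>2))"
        using win by simp
      moreover note level_minimizers_derq[OF M, folded P_def Q'_def, unfolded dq]
      ultimately have "(P, Q) \<in> C3 q"
        unfolding C3_def mem_Collect_eq prod.case using L'(5,12) by blast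
      then show ?thesis using q by (auto simp: C_def)
    next
      assume "curr_active N i y"
      then have l: "curr y = (Irated N i)\<^sup>2" by (simp add: curr_active_def)
      have "2 * x * Q' = 2 * x * \<kappa> * Q + (2 * r - \<kappa> * \<alpha>) * P + (v - 2 * r * c + D * (Irated N i)\<^sup>2 - \<kappa> * W)"
        using win unfolding l by (simp add: algebra_simps)
      then have "Q' = (2 * x * \<kappa> * Q + (2 * r - \<kappa> * \<alpha>) * P + (v - 2 * r * c + D * (Irated N i)\<^sup>2 - \<kappa> * W)) / (2 * x)"
        using rea_i by (simp add: eq_divide_eq mult.commute)
      then have Q': "\<kappa> * Q + (2 * r - \<kappa> * \<alpha>) / (2 * x) * P
        + (v - 2 * r * c + D * (Irated N i)\<^sup>2 - \<kappa> * W) / (2 * x) = Q'"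
        using rea_i by (simp add: add_divide_distrib)
      have "(P, Q) \<in> C2" unfolding C2_def using circ Q' L'(12) l by simp
      then show ?thesis by (simp add: C_def)
    next
      assume "reaQ y = x * v / D"
      then have "Q' = q0" by (simp add: Q'_def q0_def)
      then have "(P, Q) \<in> C4"
        unfolding C4_def using circ win unfolding curr
        by (simp add: algebra_simps power2_eq_square add_divide_distrib diff_divide_distrib)
      then show ?thesis by (simp add: C_def)
    qed
    moreover have "Q' \<in> R (P, Q)"
      using win unfolding R_def curr
      by (simp add: algebra_simps power2_eq_square add_divide_distrib diff_divide_distrib)
    ultimately show "(actP a, reaQ a, reaQ y) \<in> T" by (force simp: T_def P_def Q_def Q'_def)
  qed auto
qed

lemma finite_level_minimizers:
  assumes "2 * c < v / r"
  shows "finite (level_minimizers c)"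
proof -
  have "level_minimizers c \<subseteq> {(a, b, y) \<in> level_minimizers c. line_pinned N i t a}
     \<union> (\<Union>\<kappa>\<in>{1 / \<Delta>, \<Delta>}. {(a, b, y) \<in> level_minimizers c. volt y = \<kappa> * volt a})"
    using minimizer_upstream by (fastforce simp: level_minimizers_def window_active_def)
  moreover have "finite \<dots>"
    using Dl_pos assms by (intro finite_UnI finite_level_pinned finite_UN_I finite_level_volt_ratio) auto
  ultimately show ?thesis by (rule finite_subset)
qed

text \<open>The other minimizers of the same value form a finite, hence closed, set that misses a
  neighbourhood of the solution. Every other feasible point there has a larger objective
  value.\<close>

lemma solution_strict_local_min:
  assumes sol: "S_solution N X i t (a, b, y)" and cond: "v - 4 * actP y * r - 4 * actP a * r \<ge> 0"
  shows "strict_local_min (S_objective N i) (S_feasible N X i t) (a, b, y)"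
proof -
  let ?f = "S_objective N i" and ?F = "S_feasible N X i t" and ?z = "(a, b, y)"
  define c where "c = actP a + actP y"
  have min: "minimizer ?z" using sol by (simp add: S_solution_def)
  then have F: "?F ?z" by (simp add: is_arg_min_def)
  \<comment> \<open>Condition (4) bounds the level \<open>c\<close> by
    \<open>v / (4 * r)\<close>.\<close>
  have "4 * c * r \<le> v" using cond by (simp add: c_def algebra_simps)
  then have "2 * c < v / r" using v res_i by (simp add: field_simps)
  then have "finite (level_minimizers c - {?z})" by (simp add: finite_level_minimizers)
  then have "\<forall>\<^sub>F u in at ?z within {u. ?F u}. u \<in> - (level_minimizers c - {?z})"
    by (intro topological_tendstoD[OF tendsto_ident_at] open_Compl finite_imp_closed) auto
  moreover have "\<forall>\<^sub>F u in at ?z within {u. ?F u}. ?F u \<and> u \<noteq> ?z"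
    by (auto simp: eventually_at_filter)
  ultimately have "\<forall>\<^sub>F u in at ?z within {u. ?F u}. ?f ?z < ?f u"
  proof eventually_elim
    case (elim u)
    obtain a' b' y' where u: "u = (a', b', y')" by (cases u)
    have "?f ?z \<le> ?f u" using is_arg_min_le[OF min] elim by simp
    moreover have "?f ?z \<noteq> ?f u"
    proof
      assume eq: "?f ?z = ?f u"
      then have "minimizer u" using min elim by (auto simp: is_arg_min_def)
      moreover have "actP a' + actP y' = c"
        using eq S_objective_eq[OF F] S_objective_eq[of a' b' y'] elim by (simp add: u c_def)
      ultimately show False using elim by (auto simp: level_minimizers_def u)
    qed
    ultimately show ?case by simp
  qed
  then show ?thesis using F by (simp add: strict_local_min_def)
qed

end

section \<open>Global convergence\<close>

theorem theorem7:
  fixes N :: network and n :: nat and X :: iterates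
    and t :: "nat \<Rightarrow> nat" and z :: "nat \<Rightarrow> sub_vars"
  assumes "n \<ge> 4"
    and "\<forall>i\<in>{1..n-1}. res N i > 0"
    and "delta_endico N n X"
    and "convergence_preserved N n X t z"
    and "\<forall>i\<in>{1..n-2}. t i \<ge> 1"
    and "\<forall>i\<in>{1..n-3}. t (i+1) \<ge> t i + 1"
    and "\<forall>i\<in>{1..n-2}. S_solution N X i (t i) (z i)"
    and "\<forall>i\<in>{1..n-2}. unit_delta_condition X i (t i) (z i)"
    and "\<forall>i\<in>{1..n-2}. sub_conditions N X i (t i) (z i)"
  shows "globally_converges N n X t z"
proof -
  have "subsystem_converges N X i (t i) (z i)" if "i \<in> {1..n-2}" for i
    using that
  proof (induction i)
    case 0
    then show ?case by simp
  next
    case (Suc m)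
    define i where "i = Suc m"
    have i: "i \<in> {1..n-2}" using Suc.prems by (simp add: i_def)
    obtain a b y where z: "z i = (a, b, y)" by (cases "z i")
    have sol: "S_solution N X i (t i) (a, b, y)" using assms(7) i z by metis
    then have feas: "S_feasible N X i (t i) (a, b, y)" by (simp add: S_solution_def is_arg_min_def)
    \<comment> \<open>For the first subsystem node \<open>i\<close> is the source, whose voltage is
      constant. Otherwise it is the middle node of the preceding subsystem, which converges by
      induction, and preservation applies.\<close>
    have "vm X i (t i - 1) = vm X i (t i)"
    proof (cases "m = 0")
      case True
      then show ?thesis using assms(3) by (simp add: i_def delta_endico_def) metis
    next
      case False
      then have m: "m \<in> {1..n-3}" "m \<in> {1..n-2}" using Suc.prems by auto
      have "t m + 1 \<le> t (m+1)" using assms(6) m by blast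
      then show ?thesis using assms(4) Suc.IH[OF m(2)] m(1)
        by (auto simp: convergence_preserved_def i_def)
    qed
    moreover have pos: "v > 0" if "volt_ok v" for v
      using that by (simp add: volt_ok_def Vmin_def power2_eq_square)
    have "vm X i (t i) > 0" using feas by (intro pos) (simp add: S_feasible.simps)
    \<comment> \<open>With parameter \<open>1\<close> the two sides of the window collapse to an
      equality, which is also the voltage clause of convergence.\<close>
    moreover have vj: "vm X (i+1) (t i - 1) = volt a"
      using assms(8) i z by (force simp: unit_delta_condition_def delta_window_def)
    moreover have "volt a > 0"
      using feas by (intro pos) (simp add: S_feasible.simps var_bounds_iff)
    \<comment> \<open>These are conditions (1) and (4); the first makes the reactance
      positive.\<close>
    moreover have cond: "rea N i \<ge> res N i"
      "vm X i (t i - 1) - 4 * actP y * res N i - 4 * actP a * res N i \<ge> 0"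
      using assms(9) i z by (auto simp: sub_conditions_def Let_def dest!: bspec[of _ _ i])
    moreover have res: "res N i > 0" "res N (i+1) > 0" using assms(1,2) i by auto
    moreover have "Dl X (i+1) (t i + 1) \<ge> 1"
      using assms(3) i assms(1) unfolding delta_endico_def by auto
    ultimately interpret two_step_problem N X i "t i" "vm X i (t i)" "volt a"
      by unfold_locales auto
    have "strict_local_min (S_objective N i) (S_feasible N X i (t i)) (a, b, y)"
      using sol cond(2) vm_i by (intro solution_strict_local_min) auto
    then show ?case using sol vj z by (simp add: subsystem_converges_def i_def)
  qed
  then show ?thesis using assms(6) by (simp add: globally_converges_def)
qed

end
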